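(* Let $G$ be a finite simple graph whose edge ideal $I_G$ has jump sequence $[k;a_1,a_2,\dots,a_{k-1}]$ with $k\ge 3$. Then $2a_1\le a_2$.
   Context: Let $\Bbbk$ be a field of characteristic zero. For a finite simple graph $G=(V,E)$ on $n$ vertices with at least one edge, let $R=\Bbbk[x_1,\dots,x_n]$ have one variable per vertex, and let the edge ideal be $I_G=(x_ix_j:\{i,j\}\in E)$. Convention: $\beta_{i,j}=\beta_{i,j}(I_G)$ denotes the graded Betti number of the quotient $R/I_G$ in homological degree $i$ and internal degree $j$ (so $\beta_{1,2}$ is the number of edges of $G$), and $\mathrm{reg}(I_G)=\max\{j-i+1:\beta_{i,j}\ne 0\}$. If $\mathrm{reg}(I_G)=k+1$, the jump sequence of $G$ (or of $I_G$) is $[k;a_1,\dots,a_{k-1}]$, where $a_r=\min\{i:\beta_{i,i+r+1}\neq 0\}-1$ for $1\le r\le k-1$; if $I_G$ has a linear resolution ($k=1$) the jump sequence is $[1;\emptyset]$. *)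

theory Defs
  imports "HOL-Library.Poly_Mapping" "Jordan_Normal_Form.Matrix_Kernel"
begin

text \<open>Finite simple graphs: the vertex set is the whole of a finite type \<open>'v\<close>, and the edges are
  given as a set of two-element vertex sets.\<close>

definition simple_graph :: "'v::finite set set \<Rightarrow> bool" where
  "simple_graph E \<longleftrightarrow> (\<forall>e\<in>E. card e = 2)"

text \<open>The polynomial ring with one variable per element of \<open>'v\<close>: finitely supported maps from
  exponent vectors to coefficients, with the convolution product of \<open>Poly_Mapping\<close>.\<close>

type_synonym ('v, 'k) mpoly = "('v \<Rightarrow>\<^sub>0 nat) \<Rightarrow>\<^sub>0 'k"

definition Var :: "'v \<Rightarrow> ('v, 'k::comm_ring_1) mpoly" where
  "Var v = Poly_Mapping.single (Poly_Mapping.single v 1) 1"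

definition monom_deg :: "('v \<Rightarrow>\<^sub>0 nat) \<Rightarrow> nat" where
  "monom_deg m = (\<Sum>v\<in>Poly_Mapping.keys m. Poly_Mapping.lookup m v)"

text \<open>The ideal generated by a set is its span in the ring regarded as a module over itself.\<close>

definition edge_ideal :: "'v::finite set set \<Rightarrow> ('v, 'k::comm_ring_1) mpoly set" where
  "edge_ideal E = Modules.module.span (*) {Var u * Var v | u v. {u, v} \<in> E}"

text \<open>A minimal graded free resolution
  \[ \cdots \to F_2 \to F_1 \to F_0 = R \to R/I \to 0, \qquad F_i = \bigoplus_b R(-d_b), \]
  with every \<open>F i\<close> of finite rank, is given by the lists \<open>s i\<close> of the degrees \<open>d_b\<close> of the
  basis elements of \<open>F i\<close> and the matrices \<open>A i\<close> of the differentials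
  \<open>F (Suc i) \<rightarrow> F i\<close> (acting on column vectors). The augmentation is the canonical projection
  from \<open>R\<close> to \<open>R/I\<close>, so \<open>I\<close> is assumed to be a proper homogeneous ideal. The conditions say, in
  this order: \<open>F 0 = R\<close> generated in degree \<open>0\<close>; the sizes of the matrices; the differentials
  preserve degrees; the differentials map into the maximal homogeneous ideal times the next
  module, that is, no matrix entry has a constant term; exactness at \<open>F 0\<close>; exactness at
  \<open>F (Suc i)\<close>.\<close>

definition minimal_graded_free_resolution ::
  "('v, 'k::field) mpoly set \<Rightarrow> (nat \<Rightarrow> nat list) \<Rightarrow> (nat \<Rightarrow> ('v, 'k) mpoly mat) \<Rightarrow> bool" where
  "minimal_graded_free_resolution I s A \<longleftrightarrow>
     s 0 = [0] \<and>
     (\<forall>i. A i \<in> carrier_mat (length (s i)) (length (s (Suc i)))) \<and>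
     (\<forall>i. \<forall>b < length (s i). \<forall>c < length (s (Suc i)).
        \<forall>m \<in> Poly_Mapping.keys (A i $$ (b, c)). monom_deg m + s i ! b = s (Suc i) ! c) \<and>
     (\<forall>i. \<forall>b < length (s i). \<forall>c < length (s (Suc i)). Poly_Mapping.lookup (A i $$ (b, c)) 0 = 0) \<and>
     (\<lambda>v. A 0 *\<^sub>v v) ` carrier_vec (length (s 1)) = {w \<in> carrier_vec 1. w $ 0 \<in> I} \<and>
     (\<forall>i. (\<lambda>v. A (Suc i) *\<^sub>v v) ` carrier_vec (length (s (Suc (Suc i)))) = mat_kernel (A i))"

text \<open>\<open>has_graded_betti_numbers I \<beta>\<close>: the number of basis elements of degree \<open>j\<close> in homological
  degree \<open>i\<close> of a minimal graded free resolution of \<open>R/I\<close> (not of \<open>I\<close>) is \<open>\<beta> i j\<close>. Such a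
  resolution always exists and is unique up to isomorphism, so this determines \<open>\<beta>\<close>.\<close>

definition has_graded_betti_numbers ::
  "('v, 'k::field) mpoly set \<Rightarrow> (nat \<Rightarrow> nat \<Rightarrow> nat) \<Rightarrow> bool" where
  "has_graded_betti_numbers I \<beta> \<longleftrightarrow>
     (\<exists>s A. minimal_graded_free_resolution I s A \<and> (\<forall>i j. \<beta> i j = count_list (s i) j))"

text \<open>The regularity of the ideal \<open>I\<close> in terms of the Betti numbers of \<open>R/I\<close>, whence the
  summand \<open>1\<close>. Only finitely many of them are non-zero, by Hilbert's syzygy theorem.\<close>

definition regularity :: "(nat \<Rightarrow> nat \<Rightarrow> nat) \<Rightarrow> int" where
  "regularity \<beta> = Max {int j - int i + 1 | i j. \<beta> i j \<noteq> 0}"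

text \<open>\<open>I\<close> has jump sequence \<open>[k; a 1, \<dots>, a (k - 1)]\<close>: here \<open>a r + 1\<close> is the least element
  of the set of all \<open>i\<close> with \<open>\<beta> i (i + r + 1) \<noteq> 0\<close>. Values of \<open>a\<close> outside \<open>{1..k - 1}\<close> are
  irrelevant.\<close>

definition has_jump_sequence ::
  "('v, 'k::field) mpoly set \<Rightarrow> nat \<Rightarrow> (nat \<Rightarrow> nat) \<Rightarrow> bool" where
  "has_jump_sequence I k a \<longleftrightarrow>
     (\<exists>\<beta>. has_graded_betti_numbers I \<beta> \<and>
        regularity \<beta> = int k + 1 \<and>
        (\<forall>r. 1 \<le> r \<and> r \<le> k - 1 \<longrightarrow>
           \<beta> (a r + 1) ((a r + 1) + r + 1) \<noteq> 0 \<and>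
           (\<forall>i. \<beta> i (i + r + 1) \<noteq> 0 \<longrightarrow> a r + 1 \<le> i)))"

end

theory Submission
  imports Defs "HOL-Library.Countable"
begin

text \<open>By Hochster's formula, \<open>\<beta>\<^bsub>i,i+r+1\<^esub> \<noteq> 0\<close> iff some \<open>i + r + 1\<close> vertices span a subcomplex with
  non-zero \<open>r\<close>-dimensional cohomology of the independence complex. We only need non-vanishing:
  walking down the double complex of a minimal resolution and the Koszul complex identifies
  generators of \<open>F\<^sub>i\<close> with Koszul homology of \<open>R / I\<close>, which a contracting homotopy concentrates in
  squarefree multidegrees.

  Let \<open>p = a\<^sub>1\<close>, so that non-zero \<open>H\<^sup>1\<close> requires \<open>p + 3\<close> vertices, and let \<open>W\<close> be minimal with
  \<open>H\<^sup>2 \<noteq> 0\<close>. For \<open>v \<in> W\<close> the link of \<open>v\<close>, which is induced on the non-neighbours \<open>N\<close> of \<open>v\<close>, carries a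
  \<open>1\<close>-cocycle that does not extend to \<open>W - v\<close>; hence \<open>N\<close> has at least \<open>p + 3\<close> elements. Extending the
  cocycle vertex by vertex gets stuck at some \<open>u\<close> outside \<open>N\<close>, because \<open>H\<^sup>1\<close> of the link of \<open>u\<close>
  in the part already reached is non-zero. If \<open>p \<ge> 2\<close> then there is no induced four-cycle in the complement
  graph, so the link of \<open>u\<close> meets \<open>N\<close> in a face. A suitable cycle in the link of \<open>u\<close> has at least \<open>p + 3\<close>
  vertices and at most three of them in that face, so at least \<open>p\<close> vertices of \<open>W\<close> lie outside
  \<open>N\<close> and \<open>v\<close>. Together this gives \<open>2p + 4\<close> vertices.\<close>

section \<open>Cochains of the independence complex\<close>

text \<open>The incidence sign for inserting \<open>v\<close> at its ordered place;
  \<open>to_nat\<close> serves as an arbitrary total order on the vertices.\<close>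

definition eps :: "'v::finite \<Rightarrow> 'v set \<Rightarrow> 'a::comm_ring_1" where
  "eps v \<sigma> = (-1) ^ card {w \<in> \<sigma>. to_nat w < to_nat v}"

lemma eps_empty [simp]: "eps v {} = 1"
  by (simp add: eps_def)

lemma eps_mult_self [simp]: "eps v \<sigma> * eps v \<sigma> = 1"
  by (simp add: eps_def flip: power_add)

lemma eps_mult_self_left [simp]: "eps v \<sigma> * (eps v \<sigma> * x) = x"
  by (simp flip: mult.assoc)

lemma eps_mult_eq_0_iff [simp]: "eps v \<sigma> * x = 0 \<longleftrightarrow> x = 0"
  by (metis eps_mult_self_left mult_zero_right)

lemma eps_insert:
  assumes "w \<notin> \<sigma>"
  shows "eps v (insert w \<sigma>) = (if to_nat w < to_nat v then - eps v \<sigma> else eps v \<sigma>)"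
proof -
  have "{u \<in> insert w \<sigma>. to_nat u < to_nat v} = (if to_nat w < to_nat v
    then insert w {u \<in> \<sigma>. to_nat u < to_nat v} else {u \<in> \<sigma>. to_nat u < to_nat v})"
    by auto
  then show ?thesis
    using assms by (auto simp: eps_def)
qed

text \<open>Exactly one of \<open>v\<close> and \<open>w\<close> precedes the other, so exactly one
  of the two insertions flips a sign. Both \<open>cobd_cobd\<close> and \<open>koszul_koszul\<close>
  rest on this.\<close>

lemma eps_swap:
  assumes "v \<notin> \<sigma>" "w \<notin> \<sigma>" "v \<noteq> w"
  shows "eps v (insert w \<sigma>) * eps w \<sigma> = - (eps w (insert v \<sigma>) * eps v \<sigma>)"
proof -
  have "to_nat v \<noteq> to_nat w"
    using assms(3) by simp
  then show ?thesis
    using assms by (auto simp: eps_insert)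
qed

text \<open>The terms for the pairs \<open>(v, w)\<close> and \<open>(w, v)\<close> cancel. With the
  diagonal left out no division by two occurs, so the characteristic does not matter.\<close>

lemma sum_antisymmetric:
  fixes f :: "'b \<Rightarrow> 'b \<Rightarrow> 'c::ab_group_add"
  assumes "finite A" and "\<And>v w. v \<in> A \<Longrightarrow> w \<in> A \<Longrightarrow> v \<noteq> w \<Longrightarrow> f v w = - f w v"
  shows "(\<Sum>v\<in>A. \<Sum>w\<in>A - {v}. f v w) = 0"
  using assms
proof (induction A)
  case (insert x A)
  have IH: "(\<Sum>v\<in>A. \<Sum>w\<in>A - {v}. f v w) = 0"
    using insert.prems by (intro insert.IH) blast
  have "(\<Sum>v\<in>A. \<Sum>w\<in>insert x A - {v}. f v w) = (\<Sum>v\<in>A. f v x + (\<Sum>w\<in>A - {v}. f v w))"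
  proof (intro sum.cong refl)
    fix v assume "v \<in> A"
    then have "insert x A - {v} = insert x (A - {v})"
      using insert.hyps by auto
    then show "(\<Sum>w\<in>insert x A - {v}. f v w) = f v x + (\<Sum>w\<in>A - {v}. f v w)"
      using insert.hyps by simp
  qed
  also have "\<dots> = (\<Sum>v\<in>A. f v x)"
    using IH by (simp add: sum.distrib)
  also have "\<dots> = (\<Sum>v\<in>A. - f x v)"
  proof (intro sum.cong refl)
    fix v assume "v \<in> A"
    then show "f v x = - f x v"
      using insert.hyps by (intro insert.prems) auto
  qed
  finally show ?case
    using insert.hyps by (simp add: insert_Diff_if sum_negf)
qed simp

text \<open>The augmented simplicial coboundary: the empty set counts as a face, so the resulting
  cohomology is reduced. It is defined for all functions on vertex sets; faces enter only through
  \<open>cocycle\<close> and \<open>coboundary\<close>.\<close>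

definition cobd :: "('v::finite set \<Rightarrow> 'a::comm_ring_1) \<Rightarrow> 'v set \<Rightarrow> 'a" where
  "cobd \<phi> \<tau> = (\<Sum>v\<in>\<tau>. eps v (\<tau> - {v}) * \<phi> (\<tau> - {v}))"

text \<open>Restriction of a cochain to the link of \<open>v\<close>, with a sign; read differently,
  the contracting homotopy of a cone with apex \<open>v\<close>.\<close>

definition contract :: "'v::finite \<Rightarrow> ('v set \<Rightarrow> 'a::comm_ring_1) \<Rightarrow> 'v set \<Rightarrow> 'a" where
  "contract v \<phi> \<tau> = eps v \<tau> * \<phi> (insert v \<tau>)"

section \<open>Coboundary calculus and the cone homotopy\<close>

lemma cobd_cong:
  assumes "\<And>v. v \<in> \<tau> \<Longrightarrow> \<phi> (\<tau> - {v}) = \<psi> (\<tau> - {v})"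
  shows "cobd \<phi> \<tau> = cobd \<psi> \<tau>"
  using assms by (simp add: cobd_def)

lemma cobd_add: "cobd (\<lambda>\<tau>. \<phi> \<tau> + \<psi> \<tau>) \<tau> = cobd \<phi> \<tau> + cobd \<psi> \<tau>"
  by (simp add: cobd_def algebra_simps sum.distrib)

lemma cobd_diff: "cobd (\<lambda>\<tau>. \<phi> \<tau> - \<psi> \<tau>) \<tau> = cobd \<phi> \<tau> - cobd \<psi> \<tau>"
  by (simp add: cobd_def algebra_simps sum_subtractf)

lemma cobd_cobd [simp]:
  fixes \<phi> :: "'v::finite set \<Rightarrow> 'a::comm_ring_1"
  shows "cobd (cobd \<phi>) \<tau> = 0"
proof -
  define f :: "'v \<Rightarrow> 'v \<Rightarrow> 'a" where "f v w = eps v (\<tau> - {v}) * eps w (\<tau> - {v} - {w}) * \<phi> (\<tau> - {v} - {w})" for v w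
  have "cobd (cobd \<phi>) \<tau> = (\<Sum>v\<in>\<tau>. \<Sum>w\<in>\<tau> - {v}. f v w)"
    by (simp add: cobd_def f_def sum_distrib_left mult.assoc)
  also have "\<dots> = 0"
  proof (rule sum_antisymmetric)
    fix v w assume *: "v \<in> \<tau>" "w \<in> \<tau>" "v \<noteq> w"
    define \<sigma> where "\<sigma> = \<tau> - {v} - {w}"
    have "\<tau> - {v} = insert w \<sigma>" "\<tau> - {w} = insert v \<sigma>" "\<tau> - {w} - {v} = \<sigma>"
      "v \<notin> \<sigma>" "w \<notin> \<sigma>"
      using * by (auto simp: \<sigma>_def)
    moreover have "(eps v (insert w \<sigma>) * eps w \<sigma> :: 'a) = - (eps w (insert v \<sigma>) * eps v \<sigma>)"
      using * by (intro eps_swap) (auto simp: \<sigma>_def)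
    ultimately show "f v w = - f w v"
      by (simp add: f_def flip: \<sigma>_def)
  qed simp
  finally show ?thesis .
qed

text \<open>In the coboundary at \<open>insert v \<tau>\<close>, dropping \<open>v\<close> returns
  \<open>\<phi> \<tau>\<close>, and by \<open>eps_swap\<close> the other summands form the
  coboundary of the contraction with opposite sign. Every later argument about links goes through
  this identity.\<close>

lemma cone_formula:
  fixes \<phi> :: "'v::finite set \<Rightarrow> 'a::comm_ring_1"
  assumes "v \<notin> \<tau>"
  shows "contract v (cobd \<phi>) \<tau> + cobd (contract v \<phi>) \<tau> = \<phi> \<tau>"
proof -
  have "(\<Sum>w\<in>\<tau>. eps w (insert v \<tau> - {w}) * \<phi> (insert v \<tau> - {w}))
      = - (eps v \<tau> * (\<Sum>w\<in>\<tau>. eps w (\<tau> - {w}) * (eps v (\<tau> - {w}) * \<phi> (insert v (\<tau> - {w})))))"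
    unfolding sum_distrib_left sum_negf[symmetric]
  proof (rule sum.cong)
    fix w assume w: "w \<in> \<tau>"
    define \<sigma> where "\<sigma> = \<tau> - {w}"
    have s: "w \<notin> \<sigma>" "v \<notin> \<sigma>" "v \<noteq> w" "\<tau> = insert w \<sigma>" "insert v \<tau> - {w} = insert v \<sigma>"
      using w assms by (auto simp: \<sigma>_def)
    have "(eps w (insert v \<sigma>) :: 'a) = (eps w (insert v \<sigma>) * eps v \<sigma>) * eps v \<sigma>"
      by (simp add: mult.assoc)
    also have "eps w (insert v \<sigma>) * eps v \<sigma> = - (eps v (insert w \<sigma>) * eps w \<sigma> :: 'a)"
      using s by (intro eps_swap) auto
    also have "\<dots> * eps v \<sigma> = - (eps v \<tau> * (eps w \<sigma> * eps v \<sigma>))"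
      using s by (simp add: mult.assoc)
    finally show "eps w (insert v \<tau> - {w}) * \<phi> (insert v \<tau> - {w})
       = - (eps v \<tau> * (eps w (\<tau> - {w}) * (eps v (\<tau> - {w}) * \<phi> (insert v (\<tau> - {w})))))"
      unfolding s(5) \<sigma>_def[symmetric] by (simp add: mult.assoc)
  qed simp
  moreover have "insert v \<tau> - {v} = \<tau>"
    using assms by auto
  ultimately have "cobd \<phi> (insert v \<tau>) = eps v \<tau> * \<phi> \<tau> - eps v \<tau> * cobd (contract v \<phi>) \<tau>"
    using assms by (simp add: cobd_def contract_def)
  then show ?thesis
    by (simp add: contract_def right_diff_distrib)
qed

text \<open>Faces are the independent sets of the graph, that is, the cliques of its complement, and \<open>nbh\<close>
  is the neighbourhood of a vertex in the complement.\<close>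

definition face :: "'v set set \<Rightarrow> 'v set \<Rightarrow> bool" where
  "face E \<tau> \<longleftrightarrow> (\<forall>e\<in>E. \<not> e \<subseteq> \<tau>)"

definition nbh :: "'v set set \<Rightarrow> 'v \<Rightarrow> 'v set" where
  "nbh E v = {w. w \<noteq> v \<and> {v, w} \<notin> E}"

lemma simple_graphE:
  assumes "simple_graph E" "e \<in> E"
  obtains u w where "e = {u, w}" "u \<noteq> w"
  using assms by (metis simple_graph_def card_2_iff)

lemma face_iff:
  assumes "simple_graph E"
  shows "face E \<tau> \<longleftrightarrow> (\<forall>u\<in>\<tau>. \<forall>w\<in>\<tau>. {u, w} \<notin> E)"
  unfolding face_def using simple_graphE[OF assms] by (metis bot.extremum insert_subset)

lemma singleton_notin:
  assumes "simple_graph E"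
  shows "{u} \<notin> E"
  using assms by (auto simp: simple_graph_def)

lemma face_insert_iff:
  assumes "simple_graph E" "v \<notin> \<tau>"
  shows "face E (insert v \<tau>) \<longleftrightarrow> face E \<tau> \<and> \<tau> \<subseteq> nbh E v"
  using assms(2) singleton_notin[OF assms(1)]
  by (auto simp: face_iff[OF assms(1)] nbh_def insert_commute)

lemma face_subset: "face E \<tau> \<Longrightarrow> \<sigma> \<subseteq> \<tau> \<Longrightarrow> face E \<sigma>"
  by (auto simp: face_def)

text \<open>A cochain of size \<open>n\<close> lives on the faces with \<open>n\<close> vertices, hence has simplicial degree
  \<open>n - 1\<close>.\<close>

definition cocycle :: "'v::finite set set \<Rightarrow> nat \<Rightarrow> 'v set \<Rightarrow> ('v set \<Rightarrow> 'a::comm_ring_1) \<Rightarrow> bool" where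
  "cocycle E n S \<phi> \<longleftrightarrow> (\<forall>\<tau>\<subseteq>S. face E \<tau> \<longrightarrow> card \<tau> = Suc n \<longrightarrow> cobd \<phi> \<tau> = 0)"

definition coboundary :: "'v::finite set set \<Rightarrow> nat \<Rightarrow> 'v set \<Rightarrow> ('v set \<Rightarrow> 'a::comm_ring_1) \<Rightarrow> bool" where
  "coboundary E n S \<phi> \<longleftrightarrow> (\<exists>\<psi>. \<forall>\<tau>\<subseteq>S. face E \<tau> \<longrightarrow> card \<tau> = n \<longrightarrow> \<phi> \<tau> = cobd \<psi> \<tau>)"

definition nontrivial :: "'v::finite set set \<Rightarrow> nat \<Rightarrow> 'v set \<Rightarrow> ('v set \<Rightarrow> 'a::comm_ring_1) \<Rightarrow> bool" where
  "nontrivial E n S \<phi> \<longleftrightarrow> cocycle E n S \<phi> \<and> \<not> coboundary E n S \<phi>"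

lemma cocycle_subset: "cocycle E n S \<phi> \<Longrightarrow> T \<subseteq> S \<Longrightarrow> cocycle E n T \<phi>"
  by (auto simp: cocycle_def)

text \<open>Choose \<open>W\<close> of least size among the subsets of \<open>S\<close> carrying any
  non-trivial class, not only a restriction of \<open>\<phi>\<close>. Cocycles restrict to cocycles,
  so non-triviality on \<open>W - {v}\<close> would contradict the choice.\<close>

lemma nontrivial_minimal:
  fixes \<phi> :: "'v::finite set \<Rightarrow> 'a::comm_ring_1"
  assumes "nontrivial E n S \<phi>"
  obtains W \<psi> where "W \<subseteq> S" "nontrivial E n W (\<psi> :: 'v set \<Rightarrow> 'a)"
    "\<And>v. v \<in> W \<Longrightarrow> coboundary E n (W - {v}) \<psi>"
proof -
  define P where "P W \<longleftrightarrow> W \<subseteq> S \<and> (\<exists>\<psi> :: 'v set \<Rightarrow> 'a. nontrivial E n W \<psi>)" for W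
  have "P S"
    using assms by (auto simp: P_def)
  then obtain W where W: "P W" and min: "\<And>T. P T \<Longrightarrow> card W \<le> card T"
    using exists_least_iff[of "\<lambda>k. \<exists>W. card W = k \<and> P W"]
    by (metis not_less)
  then obtain \<psi> :: "'v set \<Rightarrow> 'a" where \<psi>: "W \<subseteq> S" "nontrivial E n W \<psi>"
    by (auto simp: P_def)
  have "coboundary E n (W - {v}) \<psi>" if "v \<in> W" for v
  proof (rule ccontr)
    assume "\<not> coboundary E n (W - {v}) \<psi>"
    then have "nontrivial E n (W - {v}) \<psi>"
      using \<psi>(2) by (auto simp: nontrivial_def intro: cocycle_subset)
    then have "P (W - {v})"
      using \<psi>(1) by (auto simp: P_def)
    then show False
      using min[of "W - {v}"] that by (metis card_Diff1_less finite leD)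
  qed
  then show thesis
    using that \<psi> by blast
qed

lemma insert_face_cases:
  assumes "\<tau> \<subseteq> S" "v \<in> \<tau>" "face E \<tau>" "card \<tau> = Suc n" "simple_graph E"
  obtains \<rho> where "\<tau> = insert v \<rho>" "v \<notin> \<rho>" "\<rho> \<subseteq> S \<inter> nbh E v" "face E \<rho>" "card \<rho> = n"
proof -
  have "\<tau> = insert v (\<tau> - {v})"
    using assms by auto
  moreover have "face E (\<tau> - {v})" "\<tau> - {v} \<subseteq> nbh E v"
    using face_insert_iff[OF assms(5), of v "\<tau> - {v}"] assms(2,3) by (auto simp: insert_absorb)
  ultimately show thesis
    using that[of "\<tau> - {v}"] assms by auto
qed

text \<open>Mayer--Vietoris for the deletion and the star of a vertex, which meet in its link: a class that
  dies in the deletion comes from a class of the link that does not extend to the deletion.\<close>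

lemma link_cocycle:
  fixes \<phi> :: "'v::finite set \<Rightarrow> 'a::comm_ring_1"
  assumes E: "simple_graph E" and \<phi>: "nontrivial E (Suc n) S \<phi>" and v: "v \<in> S"
    and triv: "coboundary E (Suc n) (S - {v}) \<phi>"
  obtains \<psi> :: "'v set \<Rightarrow> 'a" where "cocycle E (Suc n) S \<psi>"
    and "\<And>\<tau>. \<tau> \<subseteq> S - {v} \<Longrightarrow> face E \<tau> \<Longrightarrow> card \<tau> = Suc n \<Longrightarrow> \<psi> \<tau> = 0"
    and "cocycle E n (S \<inter> nbh E v) (contract v \<psi>)"
    and "\<And>G. cocycle E n (S - {v}) G \<Longrightarrow>
          \<exists>\<tau>\<subseteq>S \<inter> nbh E v. face E \<tau> \<and> card \<tau> = n \<and> G \<tau> \<noteq> contract v \<psi> \<tau>"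
proof -
  obtain \<chi> where \<chi>: "\<And>\<tau>. \<tau> \<subseteq> S - {v} \<Longrightarrow> face E \<tau> \<Longrightarrow> card \<tau> = Suc n \<Longrightarrow> \<phi> \<tau> = cobd \<chi> \<tau>"
    using triv by (auto simp: coboundary_def)
  \<comment> \<open>Subtracting the coboundary of the primitive keeps the class and makes it vanish
    on the deletion, so only its values on faces through \<open>v\<close> remain.\<close>
  define \<psi> where "\<psi> \<tau> = \<phi> \<tau> - cobd \<chi> \<tau>" for \<tau>
  have coc: "cobd \<psi> \<tau> = 0" if "\<tau> \<subseteq> S" "face E \<tau>" "card \<tau> = Suc (Suc n)" for \<tau>
    using \<phi> that by (simp add: \<psi>_def[abs_def] cobd_diff nontrivial_def cocycle_def)
  have zero: "\<psi> \<tau> = 0" if "\<tau> \<subseteq> S - {v}" "face E \<tau>" "card \<tau> = Suc n" for \<tau>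
    using \<chi>[OF that] by (simp add: \<psi>_def)
  have "cobd (contract v \<psi>) \<tau> = 0"
    if \<tau>: "\<tau> \<subseteq> S \<inter> nbh E v" "face E \<tau>" "card \<tau> = Suc n" for \<tau>
  proof -
    have nv: "v \<notin> \<tau>"
      using \<tau> by (auto simp: nbh_def)
    then have "cobd \<psi> (insert v \<tau>) = 0"
      using \<tau> v by (intro coc) (auto simp: face_insert_iff[OF E])
    moreover have "\<psi> \<tau> = 0"
      using \<tau> nv by (intro zero) auto
    ultimately show ?thesis
      using cone_formula[OF nv, of \<psi>] by (simp add: contract_def)
  qed
  then have link: "cocycle E n (S \<inter> nbh E v) (contract v \<psi>)"
    by (auto simp: cocycle_def)
  have ext: "\<exists>\<tau>\<subseteq>S \<inter> nbh E v. face E \<tau> \<and> card \<tau> = n \<and> G \<tau> \<noteq> contract v \<psi> \<tau>"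
    if G: "cocycle E n (S - {v}) G" for G
  proof (rule ccontr)
    assume "\<not> ?thesis"
    then have eq: "G \<tau> = contract v \<psi> \<tau>" if "\<tau> \<subseteq> S \<inter> nbh E v" "face E \<tau>" "card \<tau> = n" for \<tau>
      using that by blast
    \<comment> \<open>Extension of \<open>G\<close> by zero: its contraction at \<open>v\<close>
      vanishes, so by \<open>cone_formula\<close> its coboundary equals \<open>\<psi>\<close> on
      faces through \<open>v\<close>. On the other faces both are zero.\<close>
    define \<gamma> where "\<gamma> \<tau> = (if v \<in> \<tau> then 0 else G \<tau>)" for \<tau>
    have "\<psi> \<tau> = cobd \<gamma> \<tau>" if \<tau>: "\<tau> \<subseteq> S" "face E \<tau>" "card \<tau> = Suc n" for \<tau>
    proof (cases "v \<in> \<tau>")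
      case True
      then obtain \<rho> where \<rho>: "\<tau> = insert v \<rho>" "v \<notin> \<rho>" "\<rho> \<subseteq> S \<inter> nbh E v" "face E \<rho>" "card \<rho> = n"
        using insert_face_cases[OF \<tau>(1) _ \<tau>(2,3) E] by blast
      have "cobd (contract v \<gamma>) \<rho> = 0"
        by (simp add: cobd_def contract_def \<gamma>_def)
      then have "eps v \<rho> * cobd \<gamma> \<tau> = G \<rho>"
        using cone_formula[OF \<rho>(2), of \<gamma>] \<rho> by (simp add: contract_def \<gamma>_def)
      also have "\<dots> = eps v \<rho> * \<psi> \<tau>"
        using eq[OF \<rho>(3-5)] \<rho> by (simp add: contract_def)
      finally show ?thesis
        by (metis eps_mult_self_left)
    next
      case False
      then have "cobd \<gamma> \<tau> = cobd G \<tau>"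
        by (intro cobd_cong) (auto simp: \<gamma>_def)
      then show ?thesis
        using False \<tau> G zero[of \<tau>] by (auto simp: cocycle_def subset_Diff_insert)
    qed
    then have "coboundary E (Suc n) S \<phi>"
      unfolding coboundary_def
      by (intro exI[of _ "\<lambda>\<tau>. \<chi> \<tau> + \<gamma> \<tau>"]) (auto simp: cobd_add \<psi>_def algebra_simps)
    then show False
      using \<phi> by (simp add: nontrivial_def)
  qed
  show thesis
    using that[of \<psi>] coc zero link ext by (auto simp: cocycle_def)
qed

text \<open>Adding \<open>u\<close> attaches a cone over its link in \<open>S\<close>; a primitive
  of \<open>G\<close> on that link prescribes values on the new faces.\<close>

lemma cocycle_extend:
  fixes G :: "'v::finite set \<Rightarrow> 'a::comm_ring_1"
  assumes E: "simple_graph E" and G: "cocycle E n S G" and u: "u \<notin> S"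
    and cob: "coboundary E n (S \<inter> nbh E u) G"
  obtains G' :: "'v set \<Rightarrow> 'a" where "cocycle E n (insert u S) G'"
    and "\<And>\<tau>. \<tau> \<subseteq> S \<Longrightarrow> G' \<tau> = G \<tau>"
proof -
  obtain \<psi> where \<psi>: "\<And>\<tau>. \<tau> \<subseteq> S \<inter> nbh E u \<Longrightarrow> face E \<tau> \<Longrightarrow> card \<tau> = n \<Longrightarrow> G \<tau> = cobd \<psi> \<tau>"
    using cob by (auto simp: coboundary_def)
  \<comment> \<open>The value on sets containing \<open>u\<close> is chosen so that the contraction
    of \<open>G'\<close> at \<open>u\<close> is exactly \<open>\<psi>\<close> on sets avoiding
    \<open>u\<close>.\<close>
  define G' where "G' \<tau> = (if u \<in> \<tau> then eps u (\<tau> - {u}) * \<psi> (\<tau> - {u}) else G \<tau>)" for \<tau>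
  have "cobd G' \<tau> = 0" if \<tau>: "\<tau> \<subseteq> insert u S" "face E \<tau>" "card \<tau> = Suc n" for \<tau>
  proof (cases "u \<in> \<tau>")
    case True
    then obtain \<rho> where \<rho>: "\<tau> = insert u \<rho>" "u \<notin> \<rho>" "\<rho> \<subseteq> insert u S \<inter> nbh E u" "face E \<rho>" "card \<rho> = n"
      using insert_face_cases[OF \<tau>(1) _ \<tau>(2,3) E] by blast
    have "cobd (contract u G') \<rho> = cobd \<psi> \<rho>"
      using \<rho>(2) by (intro cobd_cong) (auto simp: contract_def G'_def)
    also have "\<dots> = G' \<rho>"
      using \<psi>[of \<rho>] \<rho> by (auto simp: G'_def subset_insert)
    finally have "eps u \<rho> * cobd G' \<tau> = 0"
      using cone_formula[OF \<rho>(2), of G'] \<rho> by (simp add: contract_def)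
    then show ?thesis
      by (metis eps_mult_self_left mult_zero_right)
  next
    case False
    then have "cobd G' \<tau> = cobd G \<tau>"
      by (intro cobd_cong) (auto simp: G'_def)
    then show ?thesis
      using False \<tau> G by (auto simp: cocycle_def subset_insert)
  qed
  then have "cocycle E n (insert u S) G'"
    unfolding cocycle_def by blast
  moreover have "G' \<tau> = G \<tau>" if "\<tau> \<subseteq> S" for \<tau>
    using that u by (auto simp: G'_def)
  ultimately show thesis
    by (rule that)
qed

section \<open>Cochains on vertices and edges\<close>

lemma cobd_singleton: "cobd h {a} = h {}"
  by (simp add: cobd_def)

lemma cobd_edge_eq_0_iff:
  fixes h :: "'v::finite set \<Rightarrow> 'a::comm_ring_1"
  assumes "a \<noteq> b"
  shows "cobd h {a, b} = 0 \<longleftrightarrow> h {a} = h {b}"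
proof -
  have "contract a (cobd h) {b} + cobd (contract a h) {b} = h {b}"
    using assms by (intro cone_formula) auto
  then have "eps a {b} * cobd h {a, b} = h {b} - h {a}"
    by (simp add: contract_def cobd_singleton algebra_simps insert_commute)
  then show ?thesis
    by (metis eps_mult_self_left mult_zero_right right_minus_eq)
qed

lemma face_edge_iff:
  assumes "simple_graph E"
  shows "face E {a, b} \<longleftrightarrow> {a, b} \<notin> E"
  using singleton_notin[OF assms] by (auto simp: face_iff[OF assms] insert_commute)

lemma nbh_sym: "w \<in> nbh E v \<longleftrightarrow> v \<in> nbh E w"
  by (auto simp: nbh_def insert_commute)

section \<open>Long induced cycles\<close>

text \<open>In the complement graph \<open>u, a, v, b\<close> is a four-cycle whose two diagonals
  are missing, so no face has three vertices. The indicator of one side has no primitive: such a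
  function would be constant along the other three sides.\<close>

lemma nontrivial_four_cycle:
  assumes E: "simple_graph E" and "{a, b} \<in> E" "{u, v} \<in> E"
    and nb: "a \<in> nbh E u" "a \<in> nbh E v" "b \<in> nbh E u" "b \<in> nbh E v"
  shows "\<exists>\<phi> :: 'v::finite set \<Rightarrow> 'a::comm_ring_1. nontrivial E 2 {u, a, v, b} \<phi>"
proof -
  define \<phi> :: "'v set \<Rightarrow> 'a" where "\<phi> \<tau> = (if \<tau> = {u, a} then 1 else 0)" for \<tau>
  have ne: "u \<noteq> v" "a \<noteq> b"
    using assms(2,3) singleton_notin[OF E] by auto
  have d: "u \<noteq> a" "u \<noteq> b" "v \<noteq> a" "v \<noteq> b" "{u, a} \<notin> E" "{u, b} \<notin> E" "{v, a} \<notin> E" "{v, b} \<notin> E"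
    using nb by (simp_all add: nbh_def) blast+
  have "cobd \<phi> \<tau> = 0" if \<tau>: "\<tau> \<subseteq> {u, a, v, b}" "face E \<tau>" "card \<tau> = Suc 2" for \<tau>
  proof -
    have "\<not> {u, v} \<subseteq> \<tau>" "\<not> {a, b} \<subseteq> \<tau>"
      using \<tau>(2) assms(2,3) unfolding face_def by blast+
    then have "\<tau> \<subseteq> {u, a} \<or> \<tau> \<subseteq> {u, b} \<or> \<tau> \<subseteq> {v, a} \<or> \<tau> \<subseteq> {v, b}"
      using \<tau>(1) by blast
    moreover have "card \<tau> \<le> 2" if "\<tau> \<subseteq> {x, y}" for x y
      using card_mono[OF _ that] by (simp add: card_insert_if split: if_splits)
    ultimately have "card \<tau> \<le> 2"
      by blast
    then show ?thesis
      using \<tau>(3) by simp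
  qed
  then have "cocycle E 2 {u, a, v, b} \<phi>"
    unfolding cocycle_def by blast
  moreover have "\<not> coboundary E 2 {u, a, v, b} \<phi>"
  proof
    assume "coboundary E 2 {u, a, v, b} \<phi>"
    then obtain h where h: "\<And>\<tau>. \<tau> \<subseteq> {u, a, v, b} \<Longrightarrow> face E \<tau> \<Longrightarrow> card \<tau> = 2 \<Longrightarrow> \<phi> \<tau> = cobd h \<tau>"
      unfolding coboundary_def by blast
    have edge: "\<phi> {x, y} = cobd h {x, y}" if "x \<in> {u, v}" "y \<in> {a, b}" for x y
    proof (rule h)
      show "card {x, y} = 2" "face E {x, y}"
        using that d by (auto simp: face_edge_iff[OF E])
    qed (use that in auto)
    have "\<phi> {u, b} = 0" "\<phi> {v, a} = 0" "\<phi> {v, b} = 0" "\<phi> {u, a} = 1"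
      using d ne by (simp_all add: \<phi>_def doubleton_eq_iff)
    then have "cobd h {u, b} = 0" "cobd h {v, a} = 0" "cobd h {v, b} = 0" "cobd h {u, a} = 1"
      using edge by auto
    moreover from this have "h {u} = h {b}" "h {v} = h {a}" "h {v} = h {b}"
      using d cobd_edge_eq_0_iff by blast+
    ultimately show False
      using cobd_edge_eq_0_iff[OF d(1), of h] by (metis zero_neq_one)
  qed
  ultimately show ?thesis
    unfolding nontrivial_def by blast
qed

text \<open>In a shortest path joining two points of \<open>N\<close> with different values of
  \<open>r\<close>, an inner point in \<open>N\<close> differs in value from one of the two ends,
  and cutting there leaves a shorter path.\<close>

lemma shortest_path:
  assumes "(a, b) \<in> R\<^sup>*" "a \<in> N" "b \<in> N" "r a \<noteq> r b"
  obtains f n where "f 0 \<in> N" "f n \<in> N" "r (f 0) \<noteq> r (f n)"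
    "\<And>i. i < n \<Longrightarrow> (f i, f (Suc i)) \<in> R" "\<And>i. 0 < i \<Longrightarrow> i < n \<Longrightarrow> f i \<notin> N"
proof -
  define P where "P n f \<longleftrightarrow> f 0 \<in> N \<and> f n \<in> N \<and> r (f 0) \<noteq> r (f n) \<and> (\<forall>i<n. (f i, f (Suc i)) \<in> R)"
    for n :: nat and f
  have "\<exists>n f. P n f"
    using assms by (auto simp: P_def rtrancl_power relpow_fun_conv)
  then obtain n where n: "\<exists>f. P n f" and min: "\<And>m. m < n \<Longrightarrow> \<not> (\<exists>f. P m f)"
    using exists_least_iff[of "\<lambda>n. \<exists>f. P n f"] by blast
  then obtain f where f: "P n f"
    by blast
  have "f i \<notin> N" if i: "0 < i" "i < n" for i
  proof
    assume fi: "f i \<in> N"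
    show False
    proof (cases "r (f i) = r (f 0)")
      case True
      then have "P (n - i) (\<lambda>j. f (i + j))"
        using f i fi by (auto simp: P_def)
      then show False
        using min[of "n - i"] i by auto
    next
      case False
      then have "P i f"
        using f i fi by (auto simp: P_def)
      then show False
        using min[of i] i by auto
    qed
  qed
  then show thesis
    using that[of f n] f by (auto simp: P_def)
qed

text \<open>By \<open>link_cocycle\<close> there is a function on the vertices of the link of
  \<open>x\<close> that extends to no locally constant function on \<open>S - {x}\<close>. Hence
  some path outside \<open>x\<close> joins two link vertices with different values; a shortest one,
  closed up through \<open>x\<close>, meets the link only in its two ends.\<close>

lemma induced_path:
  fixes \<psi> :: "'v::finite set \<Rightarrow> 'a::comm_ring_1"
  assumes E: "simple_graph E" and \<psi>: "nontrivial E 2 S \<psi>" and x: "x \<in> S"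
    and triv: "coboundary E 2 (S - {x}) \<psi>"
  obtains C \<gamma> a b where "C \<subseteq> S" "nontrivial E 2 C (\<gamma> :: 'v set \<Rightarrow> 'a)" "x \<in> C" "C \<inter> nbh E x \<subseteq> {a, b}"
proof -
  obtain \<chi> :: "'v set \<Rightarrow> 'a" where coc: "cocycle E (Suc 1) S \<chi>"
    and zero: "\<And>\<tau>. \<tau> \<subseteq> S - {x} \<Longrightarrow> face E \<tau> \<Longrightarrow> card \<tau> = Suc 1 \<Longrightarrow> \<chi> \<tau> = 0"
    and link: "cocycle E 1 (S \<inter> nbh E x) (contract x \<chi>)"
    and ext: "\<And>G. cocycle E 1 (S - {x}) G \<Longrightarrow>
          \<exists>\<tau>\<subseteq>S \<inter> nbh E x. face E \<tau> \<and> card \<tau> = 1 \<and> G \<tau> \<noteq> contract x \<chi> \<tau>"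
    using link_cocycle[OF E, of 1 S \<psi> x] \<psi> x triv by (metis Suc_1)
  define N where "N = S \<inter> nbh E x"
  define r where "r w = contract x \<chi> {w}" for w
  define R where "R = {(w, w'). w \<in> S - {x} \<and> w' \<in> S - {x} \<and> w' \<in> nbh E w}"
  have symR: "sym R"
    by (auto simp: R_def sym_def nbh_sym)
  have "\<exists>a\<in>N. \<exists>b\<in>N. (a, b) \<in> R\<^sup>* \<and> r a \<noteq> r b"
  proof (rule ccontr)
    assume "\<not> ?thesis"
    then have const: "r a = r b" if "a \<in> N" "b \<in> N" "(a, b) \<in> R\<^sup>*" for a b
      using that by blast
    \<comment> \<open>The values \<open>r\<close> spread over the components of
      \<open>S - {x}\<close> that meet \<open>N\<close>, which \<open>const\<close> makes
      consistent. All other components get the default 0.\<close>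
    define g where "g w = (if \<exists>a\<in>N. (a, w) \<in> R\<^sup>* then r (SOME a. a \<in> N \<and> (a, w) \<in> R\<^sup>*) else 0)" for w
    have g: "g w = r a" if "a \<in> N" "(a, w) \<in> R\<^sup>*" for a w
    proof -
      define a' where "a' = (SOME a. a \<in> N \<and> (a, w) \<in> R\<^sup>*)"
      have "\<exists>a. a \<in> N \<and> (a, w) \<in> R\<^sup>*"
        using that by blast
      then have "a' \<in> N \<and> (a', w) \<in> R\<^sup>*"
        unfolding a'_def by (rule someI_ex)
      moreover from this have "(a', a) \<in> R\<^sup>*"
        using that(2) sym_rtrancl[OF symR] by (meson rtrancl_trans symD)
      ultimately have "r a' = r a"
        using const that by blast
      moreover have "g w = r a'"
        using that by (auto simp: g_def a'_def)
      ultimately show ?thesis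
        by simp
    qed
    have gR: "g w = g w'" if "(w, w') \<in> R" for w w'
    proof (cases "\<exists>a\<in>N. (a, w) \<in> R\<^sup>*")
      case True
      then show ?thesis
        using g that by (metis rtrancl.rtrancl_into_rtrancl)
    next
      case False
      have "(w', w) \<in> R"
        using that symR by (auto dest: symD)
      then have "\<not> (\<exists>a\<in>N. (a, w') \<in> R\<^sup>*)"
        using False by (meson rtrancl.rtrancl_into_rtrancl)
      then show ?thesis
        using False by (simp add: g_def)
    qed
    define G where "G \<tau> = g (the_elem \<tau>)" for \<tau>
    have "cocycle E 1 (S - {x}) G"
      unfolding cocycle_def
    proof (intro allI impI)
      fix \<tau> assume \<tau>: "\<tau> \<subseteq> S - {x}" "face E \<tau>" "card \<tau> = Suc 1"
      then obtain w w' where w: "\<tau> = {w, w'}" "w \<noteq> w'"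
        by (metis Suc_1 card_2_iff)
      then have "(w, w') \<in> R"
        using \<tau> by (auto simp: R_def nbh_def face_edge_iff[OF E])
      then show "cobd G \<tau> = 0"
        using gR w by (simp add: cobd_edge_eq_0_iff G_def)
    qed
    then obtain \<tau> where \<tau>: "\<tau> \<subseteq> N" "card \<tau> = 1" "G \<tau> \<noteq> contract x \<chi> \<tau>"
      using ext unfolding N_def by blast
    then obtain w where "\<tau> = {w}" "w \<in> N"
      by (metis card_1_singletonE insert_subset)
    then show False
      using \<tau> g[of w w] by (simp add: G_def r_def)
  qed
  then obtain a0 b0 where "(a0, b0) \<in> R\<^sup>*" "a0 \<in> N" "b0 \<in> N" "r a0 \<noteq> r b0"
    by blast
  then obtain f and n :: nat where f: "f 0 \<in> N" "f n \<in> N" "r (f 0) \<noteq> r (f n)"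
    and R: "\<And>i. i < n \<Longrightarrow> (f i, f (Suc i)) \<in> R" and out: "\<And>i. 0 < i \<Longrightarrow> i < n \<Longrightarrow> f i \<notin> N"
    using shortest_path[of a0 b0 R N r] by metis
  define C where "C = insert x (f ` {..n})"
  have fS: "f i \<in> S - {x}" if "i \<le> n" for i
  proof (cases "i < n")
    case True
    then show ?thesis using R[of i] by (auto simp: R_def)
  next
    case False
    then show ?thesis using f(2) that by (auto simp: N_def nbh_def)
  qed
  have CS: "C \<subseteq> S"
    using fS x by (auto simp: C_def)
  \<comment> \<open>As \<open>\<chi>\<close> vanishes on edges avoiding \<open>x\<close>, a
    primitive \<open>h\<close> is constant along the path. At the ends the edges to \<open>x\<close>
    force \<open>r\<close> to equal \<open>h\<close> minus the constant \<open>h {x}\<close>, so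
    \<open>r\<close> would agree there.\<close>
  have "\<not> coboundary E 2 C \<chi>"
  proof
    assume "coboundary E 2 C \<chi>"
    then obtain h where h: "\<And>\<tau>. \<tau> \<subseteq> C \<Longrightarrow> face E \<tau> \<Longrightarrow> card \<tau> = 2 \<Longrightarrow> \<chi> \<tau> = cobd h \<tau>"
      unfolding coboundary_def by blast
    have step: "h {f i} = h {f (Suc i)}" if "i < n" for i
    proof -
      have nb: "f (Suc i) \<in> nbh E (f i)"
        using R[OF that] by (auto simp: R_def)
      have fc: "face E {f i, f (Suc i)}" "card {f i, f (Suc i)} = 2"
        using nb by (auto simp: nbh_def face_edge_iff[OF E])
      have "\<chi> {f i, f (Suc i)} = 0"
        using fS[of i] fS[of "Suc i"] that fc by (intro zero) auto
      moreover have "\<chi> {f i, f (Suc i)} = cobd h {f i, f (Suc i)}"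
        using that fc by (intro h) (auto simp: C_def)
      ultimately show ?thesis
        using nb by (metis cobd_edge_eq_0_iff mem_Collect_eq nbh_def)
    qed
    have "h {f i} = h {f 0}" if "i \<le> n" for i
      using that
    proof (induction i)
      case (Suc i)
      then show ?case
        using step[of i] by simp
    qed simp
    then have fn: "h {f n} = h {f 0}"
      by blast
    have "r (f i) = h {f i} - h {x}" if "i \<le> n" "f i \<in> N" for i
    proof -
      have nx: "x \<notin> {f i}" "x \<noteq> f i" "{x, f i} \<notin> E"
        using that by (auto simp: N_def nbh_def)
      then have "\<chi> {x, f i} = cobd h {x, f i}"
        using that by (intro h) (auto simp: C_def face_edge_iff[OF E])
      then have "r (f i) = contract x (cobd h) {f i}"
        by (simp add: r_def contract_def)
      also have "\<dots> = h {f i} - cobd (contract x h) {f i}"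
        using cone_formula[OF nx(1), of h] by (simp add: eq_diff_eq)
      finally show ?thesis
        by (simp add: cobd_singleton contract_def)
    qed
    then show False
      using f fn by simp
  qed
  moreover have "cocycle E 2 C \<chi>"
    using cocycle_subset[OF coc CS] by (simp add: numeral_2_eq_2)
  ultimately have "nontrivial E 2 C \<chi>"
    by (simp add: nontrivial_def)
  moreover have "C \<inter> nbh E x \<subseteq> {f 0, f n}"
  proof
    fix w assume w: "w \<in> C \<inter> nbh E x"
    then obtain i where i: "w = f i" "i \<le> n"
      by (auto simp: C_def nbh_def)
    then have "f i \<in> N"
      using w CS by (auto simp: N_def)
    then show "w \<in> {f 0, f n}"
      using out[of i] i by (cases "i = 0"; cases "i = n") auto
  qed
  ultimately show thesis
    using that[of C \<chi> "f 0" "f n"] CS by (auto simp: C_def)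
qed

text \<open>Pass to a minimal \<open>W\<close>. If it misses \<open>K\<close>, all of
  \<open>W\<close> counts. Otherwise take \<open>x\<close> in both: the clique \<open>K\<close> lies
  in \<open>x\<close> and its neighbours, so the cycle through \<open>x\<close> from
  \<open>induced_path\<close> meets \<open>K\<close> in at most \<open>x\<close> and two further
  vertices.\<close>

lemma clique_complement_bound:
  fixes \<phi> :: "'v::finite set \<Rightarrow> 'a::comm_ring_1"
  assumes E: "simple_graph E" and \<phi>: "nontrivial E 2 X \<phi>" and K: "face E K"
    and bound: "\<And>S \<phi>. nontrivial E 2 S (\<phi> :: 'v set \<Rightarrow> 'a) \<Longrightarrow> p + 3 \<le> card S"
  shows "p \<le> card (X - K)"
proof -
  obtain W and \<psi> :: "'v set \<Rightarrow> 'a" where W: "W \<subseteq> X" "nontrivial E 2 W \<psi>"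
    and min: "\<And>v. v \<in> W \<Longrightarrow> coboundary E 2 (W - {v}) \<psi>"
    using nontrivial_minimal[OF \<phi>] by blast
  show ?thesis
  proof (cases "W \<inter> K = {}")
    case True
    then have "card W \<le> card (X - K)"
      using W by (intro card_mono) auto
    then show ?thesis
      using bound[OF W(2)] by simp
  next
    case False
    then obtain x where x: "x \<in> W" "x \<in> K"
      by blast
    obtain C and \<gamma> :: "'v set \<Rightarrow> 'a" and a b where C: "C \<subseteq> W" "nontrivial E 2 C \<gamma>" "C \<inter> nbh E x \<subseteq> {a, b}"
      using induced_path[OF E W(2) x(1) min[OF x(1)]] by metis
    have "K \<subseteq> insert x (nbh E x)"
      using K x(2) by (auto simp: face_iff[OF E] nbh_def)
    then have "C \<subseteq> (X - K) \<union> {x, a, b}"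
      using C W by blast
    then have "card C \<le> card ((X - K) \<union> {x, a, b})"
      by (intro card_mono) auto
    also have "\<dots> \<le> card (X - K) + card {x, a, b}"
      by (rule card_Un_le)
    also have "card {x, a, b} \<le> 3"
      by (simp add: card_insert_if)
    finally show ?thesis
      using bound[OF C(2)] by simp
  qed
qed

text \<open>The vertices of a minimal \<open>W\<close> are counted as \<open>v\<close>, the link
  part \<open>N\<close> with at least \<open>p + 3\<close> elements, and the rest \<open>U\<close>
  with at least \<open>p\<close>.\<close>

lemma nontrivial_size_bound:
  fixes \<phi> :: "'v::finite set \<Rightarrow> 'a::comm_ring_1"
  assumes E: "simple_graph E" and \<phi>: "nontrivial E 3 W0 \<phi>"
    and bound: "\<And>S \<phi>. nontrivial E 2 S (\<phi> :: 'v set \<Rightarrow> 'a) \<Longrightarrow> p + 3 \<le> card S"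
  shows "2 * p + 4 \<le> card W0"
proof -
  obtain W and \<psi> :: "'v set \<Rightarrow> 'a" where W: "W \<subseteq> W0" "nontrivial E 3 W \<psi>"
    and min: "\<And>v. v \<in> W \<Longrightarrow> coboundary E 3 (W - {v}) \<psi>"
    using nontrivial_minimal[OF \<phi>] by blast
  have "W \<noteq> {}"
    using W(2) by (auto simp: nontrivial_def coboundary_def)
  then obtain v where v: "v \<in> W"
    by blast
  have three: "Suc 2 = 3"
    by simp
  define N where "N = W \<inter> nbh E v"
  define U where "U = W - {v} - N"
  obtain g :: "'v set \<Rightarrow> 'a" where g: "cocycle E 2 N g"
    and ext: "\<And>G. cocycle E 2 (W - {v}) G \<Longrightarrow> \<exists>\<tau>\<subseteq>N. face E \<tau> \<and> card \<tau> = 2 \<and> G \<tau> \<noteq> g \<tau>"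
    using link_cocycle[OF E, of 2 W \<psi> v] W(2) v min[OF v] unfolding N_def three by metis
  \<comment> \<open>A coboundary \<open>cobd h\<close> on \<open>N\<close> is a cocycle on every
    set, so it would extend to \<open>W - {v}\<close>, against \<open>ext\<close>.\<close>
  have "\<not> coboundary E 2 N g"
  proof
    assume "coboundary E 2 N g"
    then obtain h where "\<And>\<tau>. \<tau> \<subseteq> N \<Longrightarrow> face E \<tau> \<Longrightarrow> card \<tau> = 2 \<Longrightarrow> g \<tau> = cobd h \<tau>"
      unfolding coboundary_def by blast
    moreover have "cocycle E 2 (W - {v}) (cobd h)"
      by (simp add: cocycle_def)
    ultimately show False
      using ext by metis
  qed
  then have N: "p + 3 \<le> card N"
    using g by (intro bound[of N g]) (simp add: nontrivial_def)
  \<comment> \<open>The sets to which the link cocycle extends. A maximal one is proper by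
    \<open>ext\<close>, and \<open>cocycle_extend\<close> then shows that \<open>G\<close> is
    non-trivial on the link of any missing vertex \<open>u\<close>.\<close>
  define Q where "Q S \<longleftrightarrow> N \<subseteq> S \<and> S \<subseteq> W - {v} \<and>
    (\<exists>G. cocycle E 2 S G \<and> (\<forall>\<tau>\<subseteq>N. G \<tau> = g \<tau>))" for S
  have "Q N"
    using g by (auto simp: Q_def N_def nbh_def)
  moreover have "finite {S. Q S}"
    by simp
  ultimately obtain S where S: "Q S" and max: "\<And>T. Q T \<Longrightarrow> S \<subseteq> T \<Longrightarrow> T = S"
    using finite_has_maximal[of "{S. Q S}"] by auto
  then obtain G where G: "cocycle E 2 S G" "\<And>\<tau>. \<tau> \<subseteq> N \<Longrightarrow> G \<tau> = g \<tau>"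
    by (auto simp: Q_def)
  have NS: "N \<subseteq> S" "S \<subseteq> W - {v}"
    using S by (auto simp: Q_def)
  have "S \<noteq> W - {v}"
    using G ext by metis
  then obtain u where u: "u \<in> W - {v}" "u \<notin> S"
    using NS by blast
  have uU: "u \<in> U"
    using u NS by (auto simp: U_def)
  have uv: "{u, v} \<in> E"
    using u NS by (auto simp: N_def nbh_def insert_commute)
  have "\<not> coboundary E 2 (S \<inter> nbh E u) G"
  proof
    assume "coboundary E 2 (S \<inter> nbh E u) G"
    then obtain G' where "cocycle E 2 (insert u S) G'" "\<And>\<tau>. \<tau> \<subseteq> S \<Longrightarrow> G' \<tau> = G \<tau>"
      using cocycle_extend[OF E G(1) u(2)] by blast
    then have "Q (insert u S)"
      using u NS G(2) unfolding Q_def by (metis insert_subset subset_insertI subset_trans)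
    then show False
      using max[of "insert u S"] u by blast
  qed
  then have X: "nontrivial E 2 (S \<inter> nbh E u) G"
    using cocycle_subset[OF G(1)] by (auto simp: nontrivial_def)
  have "p \<le> card U"
  \<comment> \<open>For small \<open>p\<close> the single vertex \<open>u\<close> suffices; the
    four-cycle argument requires \<open>p + 3\<close> to exceed 4.\<close>
  proof (cases "p \<le> 1")
    case True
    moreover have "0 < card U"
      using uU by (auto simp: card_gt_0_iff)
    ultimately show ?thesis
      by simp
  next
    case False
    \<comment> \<open>An edge of \<open>E\<close> between two common neighbours would, together with
      \<open>{u, v}\<close>, give the diagonals of a four-cycle.\<close>
    have "face E (nbh E u \<inter> nbh E v)"
      unfolding face_iff[OF E]
    proof (intro ballI notI)
      fix a b assume ab: "a \<in> nbh E u \<inter> nbh E v" "b \<in> nbh E u \<inter> nbh E v" "{a, b} \<in> E"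
      then obtain \<chi> :: "'v set \<Rightarrow> 'a" where "nontrivial E 2 {u, a, v, b} \<chi>"
        using nontrivial_four_cycle[OF E ab(3) uv, where 'a='a] by blast
      then have "p + 3 \<le> card {u, a, v, b}"
        by (rule bound)
      also have "\<dots> \<le> 4"
        by (simp add: card_insert_if)
      finally show False
        using False by simp
    qed
    \<comment> \<open>What remains after removing this face consists of vertices of
      \<open>W - {v}\<close> outside \<open>nbh E v\<close>, that is, of elements of
      \<open>U\<close>.\<close>
    then have "p \<le> card (S \<inter> nbh E u - nbh E u \<inter> nbh E v)"
      using clique_complement_bound[OF E X] bound by blast
    also have "\<dots> \<le> card U"
      using NS by (intro card_mono) (auto simp: U_def N_def)
    finally show ?thesis .
  qed
  moreover have "card W = Suc (card N + card U)"
  proof -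
    have "W = insert v (N \<union> U)" "v \<notin> N \<union> U" "N \<inter> U = {}"
      using v by (auto simp: N_def U_def nbh_def)
    then show ?thesis
      by (simp add: card_Un_disjoint)
  qed
  moreover have "card W \<le> card W0"
    using W by (intro card_mono) auto
  ultimately show ?thesis
    using N by simp
qed

section \<open>The Koszul complex\<close>

lemma lookup_single_mult:
  fixes p :: "'b::cancel_comm_monoid_add \<Rightarrow>\<^sub>0 'c::comm_semiring_1"
  shows "Poly_Mapping.lookup (Poly_Mapping.single a c * p) (a + m) = c * Poly_Mapping.lookup p m"
  by (simp add: lookup_mult lookup_single when_mult)

section \<open>Exponent vectors, squarefree monomials and the edge ideal\<close>

definition unit_exp :: "'v \<Rightarrow> 'v \<Rightarrow>\<^sub>0 nat" where
  "unit_exp v = Poly_Mapping.single v 1"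

lemma lookup_unit_exp: "Poly_Mapping.lookup (unit_exp v) w = (if w = v then 1 else 0)"
  by (simp add: unit_exp_def lookup_single when_def)

lemma keys_unit_exp [simp]: "Poly_Mapping.keys (unit_exp v) = {v}"
  by (simp add: unit_exp_def)

lemma Var_eq: "Var v = Poly_Mapping.single (unit_exp v) 1"
  by (simp add: Var_def unit_exp_def)

lemma unit_exp_minus_plus:
  assumes "Poly_Mapping.lookup m v \<noteq> (0::nat)"
  shows "m - unit_exp v + unit_exp v = m"
  using assms by (intro poly_mapping_eqI) (auto simp: lookup_add lookup_minus lookup_unit_exp)

lemma lookup_Var_mult:
  fixes p :: "('v, 'k::comm_ring_1) mpoly"
  shows "Poly_Mapping.lookup (Var v * p) m =
    (if Poly_Mapping.lookup m v = 0 then 0 else Poly_Mapping.lookup p (m - unit_exp v))"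
proof (cases "Poly_Mapping.lookup m v = 0")
  case True
  have "m \<notin> Poly_Mapping.keys (Var v * p)"
  proof
    assume "m \<in> Poly_Mapping.keys (Var v * p)"
    then obtain a b where "m = a + b" "a \<in> Poly_Mapping.keys (Var v :: ('v, 'k) mpoly)"
      using keys_mult[of "Var v" p] by blast
    then show False
      using True by (auto simp: Var_eq lookup_add split: if_splits)
  qed
  then show ?thesis
    using True by (simp add: in_keys_iff)
next
  case False
  then show ?thesis
    using lookup_single_mult[of "unit_exp v" 1 p "m - unit_exp v"] unit_exp_minus_plus[OF False]
    by (simp add: Var_eq add.commute)
qed

lemma lookup_eps_mult:
  "Poly_Mapping.lookup (eps v \<sigma> * p) m = eps v \<sigma> * Poly_Mapping.lookup (p :: ('v::finite, 'k::comm_ring_1) mpoly) m"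
  by (cases "even (card {w \<in> \<sigma>. to_nat w < to_nat v})") (simp_all add: eps_def)

definition set_exp :: "'v set \<Rightarrow> 'v::finite \<Rightarrow>\<^sub>0 nat" where
  "set_exp \<sigma> = (\<Sum>v\<in>\<sigma>. unit_exp v)"

lemma lookup_set_exp: "Poly_Mapping.lookup (set_exp \<sigma>) v = (if v \<in> \<sigma> then 1 else 0)"
  by (simp add: set_exp_def lookup_sum lookup_unit_exp)

lemma keys_set_exp [simp]: "Poly_Mapping.keys (set_exp \<sigma>) = \<sigma>"
  by (auto simp: in_keys_iff lookup_set_exp split: if_splits)

lemma set_exp_eq_iff [simp]: "set_exp \<sigma> = set_exp \<tau> \<longleftrightarrow> \<sigma> = \<tau>"
  by (metis keys_set_exp)

lemma set_exp_insert: "v \<notin> \<sigma> \<Longrightarrow> set_exp (insert v \<sigma>) = unit_exp v + set_exp \<sigma>"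
  by (simp add: set_exp_def)

lemma set_exp_diff:
  assumes "v \<in> \<sigma>"
  shows "set_exp \<sigma> - unit_exp v = set_exp (\<sigma> - {v})"
  using set_exp_insert[of v "\<sigma> - {v}"] assms by (simp add: insert_absorb)

text \<open>In a squarefree multidegree the monomial and the exterior part share out
  \<open>W\<close> disjointly; this is why that strand of the Koszul complex is indexed by subsets
  of \<open>W\<close>.\<close>

lemma add_set_exp_eq_iff:
  "m + set_exp \<sigma> = set_exp W \<longleftrightarrow> \<sigma> \<subseteq> W \<and> m = set_exp (W - \<sigma>)"
proof
  assume eq: "m + set_exp \<sigma> = set_exp W"
  have l: "Poly_Mapping.lookup m v + (if v \<in> \<sigma> then 1 else 0) = (if v \<in> W then 1 else 0)" for v
    using arg_cong[OF eq, of "\<lambda>m. Poly_Mapping.lookup m v"] by (simp add: lookup_add lookup_set_exp)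
  have "v \<in> W" if "v \<in> \<sigma>" for v
    using l[of v] that by (simp split: if_splits)
  moreover have "m = set_exp (W - \<sigma>)"
  proof (rule poly_mapping_eqI)
    fix v show "Poly_Mapping.lookup m v = Poly_Mapping.lookup (set_exp (W - \<sigma>)) v"
      using l[of v] by (auto simp: lookup_set_exp split: if_splits)
  qed
  ultimately show "\<sigma> \<subseteq> W \<and> m = set_exp (W - \<sigma>)"
    by blast
next
  assume "\<sigma> \<subseteq> W \<and> m = set_exp (W - \<sigma>)"
  then show "m + set_exp \<sigma> = set_exp W"
    by (intro poly_mapping_eqI) (auto simp: lookup_add lookup_set_exp)
qed

lemma squarefree_eq_set_exp:
  assumes "\<And>v. Poly_Mapping.lookup b v < 2"
  shows "b = set_exp (Poly_Mapping.keys b)"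
proof (rule poly_mapping_eqI)
  fix v show "Poly_Mapping.lookup b v = Poly_Mapping.lookup (set_exp (Poly_Mapping.keys b)) v"
    using assms[of v] by (auto simp: lookup_set_exp in_keys_iff)
qed

lemma monom_deg_eq_sum: "monom_deg m = (\<Sum>v\<in>UNIV. Poly_Mapping.lookup m (v :: 'v::finite))"
  unfolding monom_deg_def by (intro sum.mono_neutral_left) (auto simp: in_keys_iff)

lemma monom_deg_add: "monom_deg (m + m') = monom_deg m + monom_deg (m' :: 'v::finite \<Rightarrow>\<^sub>0 nat)"
  by (simp add: monom_deg_eq_sum lookup_add sum.distrib)

lemma monom_deg_unit_exp [simp]: "monom_deg (unit_exp (v :: 'v::finite)) = 1"
  by (simp add: monom_deg_eq_sum lookup_unit_exp)

lemma monom_deg_set_exp [simp]: "monom_deg (set_exp \<sigma>) = card \<sigma>"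
  by (simp add: monom_deg_eq_sum lookup_set_exp sum.If_cases)

text \<open>A monomial ideal is tested term by term: the right-hand side defines an ideal containing
  the generators, and each term of such a polynomial is divisible by a generator. All later passages
  modulo the ideal use this test.\<close>

lemma mem_edge_ideal_iff:
  fixes q :: "('v::finite, 'k::comm_ring_1) mpoly"
  assumes E: "simple_graph E"
  shows "q \<in> edge_ideal E \<longleftrightarrow> (\<forall>m. face E (Poly_Mapping.keys m) \<longrightarrow> Poly_Mapping.lookup q m = 0)"
proof -
  interpret M: module "(*) :: ('v, 'k) mpoly \<Rightarrow> _"
    by unfold_locales (simp_all add: algebra_simps)
  define G :: "('v, 'k) mpoly set" where "G = {Var u * Var v | u v. {u, v} \<in> E}"
  define S :: "('v, 'k) mpoly set" where
    "S = {q. \<forall>m. face E (Poly_Mapping.keys m) \<longrightarrow> Poly_Mapping.lookup q m = 0}"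
  have ideal: "r * q \<in> S" if q: "q \<in> S" for r q
    unfolding S_def
  proof (intro CollectI allI impI)
    fix m :: "'v \<Rightarrow>\<^sub>0 nat" assume m: "face E (Poly_Mapping.keys m)"
    show "Poly_Mapping.lookup (r * q) m = 0"
    proof (rule ccontr)
      assume "Poly_Mapping.lookup (r * q) m \<noteq> 0"
      then have "m \<in> Poly_Mapping.keys (r * q)"
        by (simp add: in_keys_iff)
      then obtain a b where ab: "m = a + b" "b \<in> Poly_Mapping.keys q"
        using keys_mult[of r q] by blast
      have "Poly_Mapping.keys b \<subseteq> Poly_Mapping.keys m"
        by (auto simp: ab lookup_add in_keys_iff)
      then have "face E (Poly_Mapping.keys b)"
        using m by (rule face_subset[rotated])
      then show False
        using q ab(2) by (auto simp: S_def in_keys_iff)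
    qed
  qed
  have "M.span G \<subseteq> S"
  proof (rule M.span_minimal)
    show "M.subspace S"
      unfolding M.subspace_def using ideal by (auto simp: S_def lookup_add)
    show "G \<subseteq> S"
    proof
      fix g assume "g \<in> G"
      then obtain u v where g: "g = Var u * Var v" "{u, v} \<in> E"
        by (auto simp: G_def)
      have gs: "g = Poly_Mapping.single (unit_exp u + unit_exp v) 1"
        by (simp add: g Var_eq mult_single)
      have "{u, v} \<subseteq> Poly_Mapping.keys (unit_exp u + unit_exp v)"
        by (auto simp: in_keys_iff lookup_add lookup_unit_exp)
      then have "\<not> face E (Poly_Mapping.keys (unit_exp u + unit_exp v))"
        using g(2) unfolding face_def by blast
      then show "g \<in> S"
        by (auto simp: S_def gs lookup_single when_def)
    qed
  qed
  moreover have "S \<subseteq> M.span G"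
  proof
    fix q assume q: "q \<in> S"
    have "q = (\<Sum>m\<in>Poly_Mapping.keys q. Poly_Mapping.single m (Poly_Mapping.lookup q m))"
      by (intro poly_mapping_eqI) (auto simp: lookup_sum lookup_single when_def in_keys_iff)
    also have "\<dots> \<in> M.span G"
    proof (rule M.span_sum)
      fix m assume m: "m \<in> Poly_Mapping.keys q"
      then have "\<not> face E (Poly_Mapping.keys m)"
        using q by (auto simp: S_def in_keys_iff)
      then obtain u v where uv: "{u, v} \<in> E" "u \<noteq> v" "{u, v} \<subseteq> Poly_Mapping.keys m"
        using simple_graphE[OF E] unfolding face_def by metis
      \<comment> \<open>The cofactor of the generator. As \<open>u\<close> and \<open>v\<close> are
        distinct and both in the support, the truncated subtraction is exact.\<close>
      define m' where "m' = m - (unit_exp u + unit_exp v)"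
      have "m = m' + (unit_exp u + unit_exp v)"
        using uv(2,3) unfolding m'_def
        by (intro poly_mapping_eqI)
          (auto simp: lookup_add lookup_minus lookup_unit_exp in_keys_iff Suc_le_eq)
      then have "Poly_Mapping.single m (Poly_Mapping.lookup q m)
          = Poly_Mapping.single m' (Poly_Mapping.lookup q m) * (Var u * Var v)"
        by (simp add: Var_eq mult_single)
      also have "\<dots> \<in> M.span G"
        using uv by (intro M.span_scale M.span_base) (auto simp: G_def)
      finally show "Poly_Mapping.single m (Poly_Mapping.lookup q m) \<in> M.span G" .
    qed
    finally show "q \<in> M.span G" .
  qed
  ultimately have "M.span G = S"
    by blast
  then show ?thesis
    by (simp add: edge_ideal_def flip: G_def) (simp add: S_def)
qed

text \<open>\<open>z \<sigma>\<close> is the coefficient of the basis element \<open>e\<^sub>\<sigma>\<close> of the exterior algebra.\<close>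

definition koszul :: "('v::finite set \<Rightarrow> ('v, 'k::comm_ring_1) mpoly) \<Rightarrow> 'v set \<Rightarrow> ('v, 'k) mpoly" where
  "koszul z \<sigma> = (\<Sum>v\<in>-\<sigma>. eps v \<sigma> * (Var v * z (insert v \<sigma>)))"

lemma lookup_koszul:
  "Poly_Mapping.lookup (koszul z \<sigma>) m = (\<Sum>v\<in>-\<sigma>. if Poly_Mapping.lookup m v = 0 then 0
     else eps v \<sigma> * Poly_Mapping.lookup (z (insert v \<sigma>)) (m - unit_exp v))"
  unfolding koszul_def lookup_sum lookup_eps_mult lookup_Var_mult by (intro sum.cong) auto

lemma koszul_add: "koszul (\<lambda>\<sigma>. x \<sigma> + y \<sigma>) = (\<lambda>\<sigma>. koszul x \<sigma> + koszul y \<sigma>)"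
  by (simp add: koszul_def algebra_simps sum.distrib fun_eq_iff)

lemma koszul_diff: "koszul (\<lambda>\<sigma>. x \<sigma> - y \<sigma>) = (\<lambda>\<sigma>. koszul x \<sigma> - koszul y \<sigma>)"
  by (simp add: koszul_def algebra_simps sum_subtractf fun_eq_iff)

lemma koszul_mult: "koszul (\<lambda>\<sigma>. r * x \<sigma>) \<sigma> = r * koszul x \<sigma>"
  by (simp add: koszul_def sum_distrib_left algebra_simps)

lemma koszul_sum: "koszul (\<lambda>\<sigma>. \<Sum>i\<in>A. x i \<sigma>) \<sigma> = (\<Sum>i\<in>A. koszul (x i) \<sigma>)"
proof -
  have "koszul (\<lambda>\<sigma>. \<Sum>i\<in>A. x i \<sigma>) \<sigma> = (\<Sum>v\<in>-\<sigma>. \<Sum>i\<in>A. eps v \<sigma> * (Var v * x i (insert v \<sigma>)))"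
    by (simp add: koszul_def sum_distrib_left)
  also have "\<dots> = (\<Sum>i\<in>A. \<Sum>v\<in>-\<sigma>. eps v \<sigma> * (Var v * x i (insert v \<sigma>)))"
    by (rule sum.swap)
  finally show ?thesis
    by (simp add: koszul_def)
qed

lemma koszul_koszul [simp]:
  fixes z :: "'v::finite set \<Rightarrow> ('v, 'k::comm_ring_1) mpoly"
  shows "koszul (koszul z) \<sigma> = 0"
proof -
  define f where "f v w = eps v \<sigma> * eps w (insert v \<sigma>) * (Var v * Var w * z (insert w (insert v \<sigma>)))" for v w
  have "- insert v \<sigma> = - \<sigma> - {v}" for v
    by auto
  then have "koszul (koszul z) \<sigma> = (\<Sum>v\<in>-\<sigma>. \<Sum>w\<in>-\<sigma>-{v}. f v w)"
    by (simp add: koszul_def f_def sum_distrib_left algebra_simps)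
  also have "\<dots> = 0"
  proof (rule sum_antisymmetric)
    fix v w assume *: "v \<in> - \<sigma>" "w \<in> - \<sigma>" "v \<noteq> w"
    then have "(eps w (insert v \<sigma>) * eps v \<sigma> :: ('v, 'k) mpoly) = - (eps v (insert w \<sigma>) * eps w \<sigma>)"
      by (intro eps_swap) auto
    then have "eps v \<sigma> * eps w (insert v \<sigma>) = - (eps w \<sigma> * eps v (insert w \<sigma>) :: ('v, 'k) mpoly)"
      by (simp add: mult.commute)
    then show "f v w = - f w v"
      by (simp add: f_def insert_commute mult.commute)
  qed simp
  finally show ?thesis .
qed

text \<open>The multidegree of \<open>x\<^sup>m e\<^sub>\<sigma>\<close> is \<open>m + set_exp \<sigma>\<close>. In multidegree \<open>b\<close> with \<open>c b = Some v\<close> the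
  homotopy multiplies by \<open>e\<^sub>v / x\<^sub>v\<close>, and it vanishes where \<open>c b = None\<close>.\<close>

definition homotopy :: "(('v::finite \<Rightarrow>\<^sub>0 nat) \<Rightarrow> 'v option) \<Rightarrow>
    ('v set \<Rightarrow> ('v, 'k::comm_ring_1) mpoly) \<Rightarrow> 'v set \<Rightarrow> ('v, 'k) mpoly" where
  "homotopy c z \<sigma> = Abs_poly_mapping (\<lambda>m. case c (m + set_exp \<sigma>) of None \<Rightarrow> 0
     | Some v \<Rightarrow> if v \<in> \<sigma> then eps v (\<sigma> - {v}) * Poly_Mapping.lookup (z (\<sigma> - {v})) (m + unit_exp v) else 0)"

text \<open>\<open>Abs_poly_mapping\<close> is meaningful only for finite support: non-zero
  positions lie in preimages, under injective shifts, of the supports of finitely many coefficients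
  of \<open>z\<close>.\<close>

lemma lookup_homotopy:
  "Poly_Mapping.lookup (homotopy c z \<sigma>) m = (case c (m + set_exp \<sigma>) of None \<Rightarrow> 0
     | Some v \<Rightarrow> if v \<in> \<sigma> then eps v (\<sigma> - {v}) * Poly_Mapping.lookup (z (\<sigma> - {v})) (m + unit_exp v) else 0)"
proof -
  define f where "f m = (case c (m + set_exp \<sigma>) of None \<Rightarrow> 0
     | Some v \<Rightarrow> if v \<in> \<sigma> then eps v (\<sigma> - {v}) * Poly_Mapping.lookup (z (\<sigma> - {v})) (m + unit_exp v) else 0)" for m
  have "{m. f m \<noteq> 0} \<subseteq> (\<Union>v. (\<lambda>m. m + unit_exp v) -` Poly_Mapping.keys (z (\<sigma> - {v})))"
  proof
    fix m assume "m \<in> {m. f m \<noteq> 0}"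
    then obtain v where "Poly_Mapping.lookup (z (\<sigma> - {v})) (m + unit_exp v) \<noteq> 0"
      by (auto simp: f_def split: option.splits if_splits)
    then show "m \<in> (\<Union>v. (\<lambda>m. m + unit_exp v) -` Poly_Mapping.keys (z (\<sigma> - {v})))"
      by (auto simp: in_keys_iff)
  qed
  moreover have "finite (\<Union>v. (\<lambda>m. m + unit_exp v) -` Poly_Mapping.keys (z (\<sigma> - {v})))"
    by (intro finite_UN_I finite_vimageI) (auto simp: inj_on_def)
  ultimately have "finite {m. f m \<noteq> 0}"
    by (rule finite_subset)
  then show ?thesis
    unfolding homotopy_def by (simp flip: f_def)
qed

text \<open>The Koszul differential preserves the multidegree, so \<open>c\<close> makes the same
  choice for every summand.\<close>

lemma homotopy_multidegree:
  assumes "Poly_Mapping.lookup m w \<noteq> 0" "w \<notin> \<sigma>"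
  shows "m - unit_exp w + set_exp (insert w \<sigma>) = m + set_exp \<sigma>"
  using unit_exp_minus_plus[OF assms(1)] by (simp add: set_exp_insert[OF assms(2)] flip: add.assoc)

text \<open>If \<open>v\<close> is not in \<open>\<sigma>\<close>, only the summand inserting and
  then removing \<open>v\<close> survives. If \<open>v\<close> is in \<open>\<sigma>\<close>,
  \<open>eps_swap\<close> cancels all summands except the one removing and then reinserting
  \<open>v\<close>.\<close>

lemma koszul_homotopy:
  fixes z :: "'v::finite set \<Rightarrow> ('v, 'k::comm_ring_1) mpoly"
  assumes c: "c (m + set_exp \<sigma>) = Some v" and v: "Poly_Mapping.lookup (m + set_exp \<sigma>) v \<noteq> 0"
  shows "Poly_Mapping.lookup (koszul (homotopy c z) \<sigma>) m + Poly_Mapping.lookup (homotopy c (koszul z) \<sigma>) m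
    = Poly_Mapping.lookup (z \<sigma>) m"
proof (cases "v \<in> \<sigma>")
  case False
  then have mv: "Poly_Mapping.lookup m v \<noteq> 0"
    using v by (simp add: lookup_add lookup_set_exp)
  have "Poly_Mapping.lookup (koszul (homotopy c z) \<sigma>) m
      = (\<Sum>w\<in>-\<sigma>. if w = v then Poly_Mapping.lookup (z \<sigma>) m else 0)"
    unfolding lookup_koszul
  proof (rule sum.cong)
    fix w assume w: "w \<in> - \<sigma>"
    have "insert v \<sigma> - {v} = \<sigma>"
      using False by auto
    then show "(if Poly_Mapping.lookup m w = 0 then 0 else eps w \<sigma> *
        Poly_Mapping.lookup (homotopy c z (insert w \<sigma>)) (m - unit_exp w)) =
        (if w = v then Poly_Mapping.lookup (z \<sigma>) m else 0)"
      using w c False mv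
      by (cases "Poly_Mapping.lookup m w = 0")
        (auto simp: lookup_homotopy homotopy_multidegree unit_exp_minus_plus)
  qed simp
  also have "\<dots> = Poly_Mapping.lookup (z \<sigma>) m"
    using False by simp
  finally show ?thesis
    using False c by (simp add: lookup_homotopy)
next
  case True
  define \<rho> where "\<rho> = \<sigma> - {v}"
  have s: "\<sigma> = insert v \<rho>" "v \<notin> \<rho>"
    using True by (auto simp: \<rho>_def)
  have "Poly_Mapping.lookup (koszul (homotopy c z) \<sigma>) m
      = (\<Sum>w\<in>-\<sigma>. - (eps v \<rho> * (if Poly_Mapping.lookup (m + unit_exp v) w = 0 then 0
           else eps w \<rho> * Poly_Mapping.lookup (z (insert w \<rho>)) (m + unit_exp v - unit_exp w))))"
    unfolding lookup_koszul
  proof (rule sum.cong)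
    fix w assume w: "w \<in> - \<sigma>"
    then have wv: "w \<noteq> v" "w \<notin> \<rho>"
      using s by auto
    have l: "Poly_Mapping.lookup (m + unit_exp v) w = Poly_Mapping.lookup m w"
      using wv by (simp add: lookup_add lookup_unit_exp)
    have "m - unit_exp w + unit_exp v = m + unit_exp v - unit_exp w" if "Poly_Mapping.lookup m w \<noteq> 0"
      using that wv by (intro poly_mapping_eqI) (auto simp: lookup_add lookup_minus lookup_unit_exp)
    moreover have "insert w \<sigma> - {v} = insert w \<rho>"
      using s wv by auto
    moreover have "eps w \<sigma> * (eps v (insert w \<rho>) * x) = - (eps v \<rho> * (eps w \<rho> * x))" for x :: 'k
    proof -
      have swap: "(eps w (insert v \<rho>) * eps v \<rho> :: 'k) = - (eps v (insert w \<rho>) * eps w \<rho>)"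
        using wv s by (intro eps_swap) auto
      have "eps w \<sigma> * (eps v (insert w \<rho>) * x)
          = (eps w (insert v \<rho>) * eps v \<rho>) * (eps v \<rho> * (eps v (insert w \<rho>) * x))"
        by (simp add: s(1) mult.assoc)
      also have "\<dots> = - (eps v (insert w \<rho>) * (eps v (insert w \<rho>) * (eps v \<rho> * (eps w \<rho> * x))))"
        unfolding swap by (simp only: ac_simps mult_minus_left mult_minus_right)
      finally show ?thesis
        by simp
    qed
    ultimately show "(if Poly_Mapping.lookup m w = 0 then 0 else eps w \<sigma> *
        Poly_Mapping.lookup (homotopy c z (insert w \<sigma>)) (m - unit_exp w)) =
        - (eps v \<rho> * (if Poly_Mapping.lookup (m + unit_exp v) w = 0 then 0
           else eps w \<rho> * Poly_Mapping.lookup (z (insert w \<rho>)) (m + unit_exp v - unit_exp w)))"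
      using w c True l by (auto simp: lookup_homotopy homotopy_multidegree)
  qed simp
  also have "\<dots> = - (eps v \<rho> * (\<Sum>w\<in>-\<sigma>. if Poly_Mapping.lookup (m + unit_exp v) w = 0 then 0
           else eps w \<rho> * Poly_Mapping.lookup (z (insert w \<rho>)) (m + unit_exp v - unit_exp w)))"
    by (simp add: sum_negf sum_distrib_left)
  finally have "Poly_Mapping.lookup (koszul (homotopy c z) \<sigma>) m = \<dots>" .
  moreover have "Poly_Mapping.lookup (koszul z \<rho>) (m + unit_exp v) = eps v \<rho> * Poly_Mapping.lookup (z \<sigma>) m
      + (\<Sum>w\<in>-\<sigma>. if Poly_Mapping.lookup (m + unit_exp v) w = 0 then 0
           else eps w \<rho> * Poly_Mapping.lookup (z (insert w \<rho>)) (m + unit_exp v - unit_exp w))"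
  proof -
    have "- \<rho> = insert v (- \<sigma>)" "v \<notin> - \<sigma>"
      using s by auto
    then show ?thesis
      unfolding lookup_koszul using s by (simp add: lookup_add lookup_unit_exp)
  qed
  moreover have "Poly_Mapping.lookup (homotopy c (koszul z) \<sigma>) m
      = eps v \<rho> * Poly_Mapping.lookup (koszul z \<rho>) (m + unit_exp v)"
    using c True by (simp add: lookup_homotopy \<rho>_def)
  ultimately show ?thesis
    by (simp add: distrib_left)
qed

lemma lookup_koszul_homotopy_None:
  assumes "c (m + set_exp \<sigma>) = None"
  shows "Poly_Mapping.lookup (koszul (homotopy c z) \<sigma>) m = 0"
  unfolding lookup_koszul using assms
  by (intro sum.neutral) (auto simp: lookup_homotopy homotopy_multidegree)

text \<open>Elements of exterior degree \<open>q\<close> and total degree \<open>j\<close>, where the coefficients live in a free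
  module with a generator of degree \<open>t\<close>.\<close>

definition homogeneous :: "nat \<Rightarrow> nat \<Rightarrow> nat \<Rightarrow> ('v::finite set \<Rightarrow> ('v, 'k::comm_ring_1) mpoly) \<Rightarrow> bool" where
  "homogeneous q t j z \<longleftrightarrow> (\<forall>\<sigma> m. Poly_Mapping.lookup (z \<sigma>) m \<noteq> 0 \<longrightarrow> card \<sigma> = q \<and> monom_deg m + q + t = j)"

lemma homogeneous_add: "homogeneous q t j x \<Longrightarrow> homogeneous q t j y \<Longrightarrow> homogeneous q t j (\<lambda>\<sigma>. x \<sigma> + y \<sigma>)"
  unfolding homogeneous_def lookup_add by (metis add_0)

lemma homogeneous_diff: "homogeneous q t j x \<Longrightarrow> homogeneous q t j y \<Longrightarrow> homogeneous q t j (\<lambda>\<sigma>. x \<sigma> - y \<sigma>)"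
  unfolding homogeneous_def lookup_minus by (metis diff_0_right)

lemma homogeneous_sum:
  "(\<And>i. i \<in> A \<Longrightarrow> homogeneous q t j (x i)) \<Longrightarrow> homogeneous q t j (\<lambda>\<sigma>. \<Sum>i\<in>A. x i \<sigma>)"
  unfolding homogeneous_def lookup_sum by (meson sum.neutral)

lemma homogeneous_zero [simp]: "homogeneous q t j (\<lambda>\<sigma>. 0)"
  by (simp add: homogeneous_def)

lemma homogeneous_koszul:
  assumes "homogeneous q t j z"
  shows "homogeneous (q - 1) t j (koszul z)"
  unfolding homogeneous_def
proof (intro allI impI)
  fix \<sigma> m assume "Poly_Mapping.lookup (koszul z \<sigma>) m \<noteq> 0"
  then obtain v where v: "v \<in> - \<sigma>" "(if Poly_Mapping.lookup m v = 0 then 0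
      else eps v \<sigma> * Poly_Mapping.lookup (z (insert v \<sigma>)) (m - unit_exp v)) \<noteq> 0"
    unfolding lookup_koszul by (rule sum.not_neutral_contains_not_neutral)
  then have m: "Poly_Mapping.lookup m v \<noteq> 0" "Poly_Mapping.lookup (z (insert v \<sigma>)) (m - unit_exp v) \<noteq> 0"
    by (auto split: if_splits)
  then have "card (insert v \<sigma>) = q" "monom_deg (m - unit_exp v) + q + t = j"
    using assms by (auto simp: homogeneous_def)
  moreover have "monom_deg m = Suc (monom_deg (m - unit_exp v))"
    using arg_cong[OF unit_exp_minus_plus[OF m(1)], of monom_deg] by (simp add: monom_deg_add)
  ultimately show "card \<sigma> = q - 1 \<and> monom_deg m + (q - 1) + t = j"
    using v(1) by auto
qed

lemma homogeneous_homotopy: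
  assumes "homogeneous q t j z"
  shows "homogeneous (Suc q) t j (homotopy c z)"
  unfolding homogeneous_def
proof (intro allI impI)
  fix \<sigma> m assume "Poly_Mapping.lookup (homotopy c z \<sigma>) m \<noteq> 0"
  then obtain v where v: "v \<in> \<sigma>" "Poly_Mapping.lookup (z (\<sigma> - {v})) (m + unit_exp v) \<noteq> 0"
    by (auto simp: lookup_homotopy split: option.splits if_splits)
  then have "card (\<sigma> - {v}) = q" "monom_deg (m + unit_exp v) + q + t = j"
    using assms by (auto simp: homogeneous_def)
  then show "card \<sigma> = Suc q \<and> monom_deg m + Suc q + t = j"
    using v(1) card_Suc_Diff1[of \<sigma> v] by (simp add: monom_deg_add)
qed

lemma koszul_exterior_degree_0:
  assumes "homogeneous 0 t j z"
  shows "koszul z \<sigma> = 0"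
proof (rule poly_mapping_eqI)
  fix m
  have "Poly_Mapping.lookup (z (insert v \<sigma>)) m' = 0" for v m'
    using assms unfolding homogeneous_def by (metis card_eq_0_iff finite insert_not_empty)
  then show "Poly_Mapping.lookup (koszul z \<sigma>) m = Poly_Mapping.lookup 0 m"
    by (simp add: lookup_koszul)
qed

lemma lookup_koszul_const: "Poly_Mapping.lookup (koszul z \<sigma>) 0 = 0"
  by (simp add: lookup_koszul)

text \<open>In a non-zero multidegree, any variable occurring there yields a contracting homotopy.
  Multidegree zero contains only the constant coefficient of the empty set, which
  \<open>const\<close> excludes.\<close>

lemma koszul_exact:
  fixes z :: "'v::finite set \<Rightarrow> ('v, 'k::comm_ring_1) mpoly"
  assumes z: "homogeneous q t j z" and cyc: "\<And>\<sigma>. koszul z \<sigma> = 0" and const: "Poly_Mapping.lookup (z {}) 0 = 0"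
  obtains y where "homogeneous (Suc q) t j y" "\<And>\<sigma>. z \<sigma> = koszul y \<sigma>"
proof -
  define c where "c b = (if b = 0 then None else Some (SOME v. Poly_Mapping.lookup b v \<noteq> 0))"
    for b :: "'v \<Rightarrow>\<^sub>0 nat"
  have "z \<sigma> = koszul (homotopy c z) \<sigma>" for \<sigma>
  proof (rule poly_mapping_eqI)
    fix m show "Poly_Mapping.lookup (z \<sigma>) m = Poly_Mapping.lookup (koszul (homotopy c z) \<sigma>) m"
    proof (cases "m + set_exp \<sigma> = 0")
      case True
      then have "m = 0" "\<sigma> = {}"
        using arg_cong[OF True, of Poly_Mapping.keys] 
        by (auto simp: poly_mapping_eq_iff fun_eq_iff lookup_add lookup_set_exp split: if_splits)
      then show ?thesis
        using const by (simp add: lookup_koszul_const)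
    next
      case False
      then have "\<exists>v. Poly_Mapping.lookup (m + set_exp \<sigma>) v \<noteq> 0"
        by (metis lookup_zero poly_mapping_eqI)
      then have "Poly_Mapping.lookup (m + set_exp \<sigma>) (SOME v. Poly_Mapping.lookup (m + set_exp \<sigma>) v \<noteq> 0) \<noteq> 0"
        by (rule someI_ex)
      moreover have "Poly_Mapping.lookup (homotopy c (koszul z) \<sigma>) m = 0"
        by (auto simp: lookup_homotopy cyc split: option.splits)
      ultimately show ?thesis
        using koszul_homotopy[of c m \<sigma> _ z] False by (simp add: c_def)
    qed
  qed
  then show thesis
    using that homogeneous_homotopy[OF z] by blast
qed

section \<open>Squarefree multidegrees\<close>

text \<open>A Hodge star sign between \<open>\<sigma>\<close> and its complement in
  \<open>W\<close>, chosen so that inserting into \<open>\<sigma>\<close> matches removing from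
  \<open>W - \<sigma>\<close>.\<close>

definition star_sign :: "'v::finite set \<Rightarrow> 'v set \<Rightarrow> 'a::comm_ring_1" where
  "star_sign W \<sigma> = (\<Prod>w\<in>\<sigma>. eps w W)"

lemma star_sign_mult_self_left [simp]:
  fixes x :: "'a::comm_ring_1"
  shows "star_sign W \<sigma> * (star_sign W \<sigma> * x) = x"
proof -
  have "star_sign W \<sigma> * star_sign W \<sigma> = (1 :: 'a)"
    by (simp add: star_sign_def flip: prod.distrib)
  then show ?thesis
    by (simp flip: mult.assoc)
qed

lemma eps_Un:
  assumes "A \<inter> B = {}"
  shows "eps v (A \<union> B) = eps v A * eps v B"
proof -
  have "{w \<in> A \<union> B. to_nat w < to_nat v} = {w \<in> A. to_nat w < to_nat v} \<union> {w \<in> B. to_nat w < to_nat v}"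
    by auto
  moreover have "{w \<in> A. to_nat w < to_nat v} \<inter> {w \<in> B. to_nat w < to_nat v} = {}"
    using assms by auto
  ultimately show ?thesis
    by (simp add: eps_def card_Un_disjoint power_add)
qed

text \<open>The vertex \<open>v\<close> does not count in its own sign, so \<open>eps v W\<close>
  factors over \<open>\<sigma>\<close> and the rest of \<open>W\<close>.\<close>

lemma star_sign_insert:
  assumes "v \<in> W" "v \<notin> \<sigma>" "\<sigma> \<subseteq> W"
  shows "eps v \<sigma> * star_sign W (insert v \<sigma>) = star_sign W \<sigma> * (eps v (W - \<sigma> - {v}) :: 'a::comm_ring_1)"
proof -
  have "W = \<sigma> \<union> insert v (W - \<sigma> - {v})"
    using assms by auto
  then have "eps v W = (eps v (\<sigma> \<union> insert v (W - \<sigma> - {v})) :: 'a)"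
    by simp
  also have "\<dots> = eps v \<sigma> * eps v (insert v (W - \<sigma> - {v}))"
    using assms by (intro eps_Un) auto
  also have "\<dots> = eps v \<sigma> * eps v (W - \<sigma> - {v})"
    by (subst eps_insert) auto
  finally have e: "eps v W = (eps v \<sigma> * eps v (W - \<sigma> - {v}) :: 'a)" .
  have "eps v \<sigma> * star_sign W (insert v \<sigma>) = eps v \<sigma> * (eps v W * (star_sign W \<sigma> :: 'a))"
    using assms by (simp add: star_sign_def)
  also have "\<dots> = eps v (W - \<sigma> - {v}) * star_sign W \<sigma>"
    unfolding e by (simp only: mult.assoc eps_mult_self_left)
  finally show ?thesis
    by (simp only: mult.commute)
qed

text \<open>The part of the Koszul complex in the squarefree multidegree of \<open>W\<close> is the simplicial cochain
  complex on \<open>W\<close>: up to a sign, the coefficient of \<open>x\<^sup>\<tau> e\<^sub>\<sigma>\<close> with \<open>\<sigma> = W - \<tau>\<close> is the value at \<open>\<tau>\<close>.\<close>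

definition cochain_of :: "'v::finite set \<Rightarrow> ('v set \<Rightarrow> ('v, 'k::comm_ring_1) mpoly) \<Rightarrow> 'v set \<Rightarrow> 'k" where
  "cochain_of W z \<tau> = star_sign W (W - \<tau>) * Poly_Mapping.lookup (z (W - \<tau>)) (set_exp \<tau>)"

definition koszul_of :: "'v::finite set \<Rightarrow> ('v set \<Rightarrow> 'k) \<Rightarrow> 'v set \<Rightarrow> ('v, 'k::comm_ring_1) mpoly" where
  "koszul_of W \<phi> \<sigma> = (if \<sigma> \<subseteq> W
     then Poly_Mapping.single (set_exp (W - \<sigma>)) (star_sign W \<sigma> * \<phi> (W - \<sigma>)) else 0)"

lemma cobd_cochain_of:
  fixes z :: "'v::finite set \<Rightarrow> ('v, 'k::comm_ring_1) mpoly"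
  assumes "\<tau> \<subseteq> W"
  shows "cobd (cochain_of W z) \<tau> = cochain_of W (koszul z) \<tau>"
proof -
  have "cochain_of W (koszul z) \<tau> = (\<Sum>v\<in>-(W - \<tau>). star_sign W (W - \<tau>) *
      (if Poly_Mapping.lookup (set_exp \<tau>) v = 0 then 0 else eps v (W - \<tau>) *
         Poly_Mapping.lookup (z (insert v (W - \<tau>))) (set_exp \<tau> - unit_exp v)))"
    by (simp add: cochain_of_def lookup_koszul sum_distrib_left)
  also have "\<dots> = (\<Sum>v\<in>\<tau>. star_sign W (W - \<tau>) * (eps v (W - \<tau>) *
         Poly_Mapping.lookup (z (insert v (W - \<tau>))) (set_exp (\<tau> - {v}))))"
    by (rule sum.mono_neutral_cong_right) (auto simp: lookup_set_exp set_exp_diff)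
  also have "\<dots> = (\<Sum>v\<in>\<tau>. eps v (\<tau> - {v}) * cochain_of W z (\<tau> - {v}))"
  proof (rule sum.cong)
    fix v assume v: "v \<in> \<tau>"
    have s: "W - (\<tau> - {v}) = insert v (W - \<tau>)" "W - (W - \<tau>) - {v} = \<tau> - {v}"
      using v assms by auto
    have swap: "eps v (W - \<tau>) * star_sign W (insert v (W - \<tau>)) = star_sign W (W - \<tau>) * (eps v (\<tau> - {v}) :: 'k)"
      using star_sign_insert[of v W "W - \<tau>", where 'a='k] v assms s(2) by auto
    have "star_sign W (W - \<tau>) * eps v (W - \<tau>)
        = (star_sign W (W - \<tau>) * eps v (\<tau> - {v})) * (eps v (\<tau> - {v}) * (eps v (W - \<tau>) :: 'k))"
      by (simp add: mult.assoc)
    also have "\<dots> = eps v (W - \<tau>) * (eps v (W - \<tau>) * (eps v (\<tau> - {v}) * star_sign W (insert v (W - \<tau>))))"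
      unfolding swap[symmetric] by (simp only: ac_simps)
    also have "\<dots> = eps v (\<tau> - {v}) * star_sign W (insert v (W - \<tau>))"
      by simp
    finally have "star_sign W (W - \<tau>) * eps v (W - \<tau>) = eps v (\<tau> - {v}) * (star_sign W (insert v (W - \<tau>)) :: 'k)" .
    then show "star_sign W (W - \<tau>) * (eps v (W - \<tau>) *
         Poly_Mapping.lookup (z (insert v (W - \<tau>))) (set_exp (\<tau> - {v})))
         = eps v (\<tau> - {v}) * cochain_of W z (\<tau> - {v})"
      by (simp add: cochain_of_def s flip: mult.assoc)
  qed simp
  finally show ?thesis
    by (simp add: cobd_def)
qed

lemma koszul_koszul_of:
  fixes \<phi> :: "'v::finite set \<Rightarrow> 'k::comm_ring_1"
  shows "koszul (koszul_of W \<phi>) = koszul_of W (cobd \<phi>)"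
proof
  fix \<sigma> :: "'v set"
  show "koszul (koszul_of W \<phi>) \<sigma> = koszul_of W (cobd \<phi>) \<sigma>"
  proof (cases "\<sigma> \<subseteq> W")
    case False
    then show ?thesis
      by (auto simp: koszul_def koszul_of_def intro!: sum.neutral)
  next
    case True
    have "koszul (koszul_of W \<phi>) \<sigma> = (\<Sum>v\<in>W - \<sigma>. eps v \<sigma> * (Var v * koszul_of W \<phi> (insert v \<sigma>)))"
      unfolding koszul_def by (rule sum.mono_neutral_right) (auto simp: koszul_of_def)
    also have "\<dots> = (\<Sum>v\<in>W - \<sigma>. Poly_Mapping.single (set_exp (W - \<sigma>))
        (star_sign W \<sigma> * (eps v (W - \<sigma> - {v}) * \<phi> (W - \<sigma> - {v}))))"
    proof (rule sum.cong)
      fix v assume v: "v \<in> W - \<sigma>"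
      have s: "W - insert v \<sigma> = W - \<sigma> - {v}"
        by auto
      have e: "set_exp (W - \<sigma>) = unit_exp v + set_exp (W - \<sigma> - {v})"
        using v set_exp_insert[of v "W - \<sigma> - {v}"] by (simp add: insert_absorb)
      have "eps v \<sigma> * star_sign W (insert v \<sigma>) = star_sign W \<sigma> * (eps v (W - \<sigma> - {v}) :: 'k)"
        using v True by (intro star_sign_insert) auto
      then have c: "eps v \<sigma> * (star_sign W (insert v \<sigma>) * x) = star_sign W \<sigma> * (eps v (W - \<sigma> - {v}) * x)" for x :: 'k
        by (metis mult.assoc)
      have "Var v * koszul_of W \<phi> (insert v \<sigma>) = Poly_Mapping.single (set_exp (W - \<sigma>))
          (star_sign W (insert v \<sigma>) * \<phi> (W - \<sigma> - {v}))"
        using v True by (simp add: koszul_of_def Var_eq mult_single s flip: e)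
      then show "eps v \<sigma> * (Var v * koszul_of W \<phi> (insert v \<sigma>)) = Poly_Mapping.single (set_exp (W - \<sigma>))
        (star_sign W \<sigma> * (eps v (W - \<sigma> - {v}) * \<phi> (W - \<sigma> - {v})))"
        by (intro poly_mapping_eqI) (simp add: lookup_eps_mult lookup_single when_def c)
    qed simp
    also have "\<dots> = Poly_Mapping.single (set_exp (W - \<sigma>)) (star_sign W \<sigma> * cobd \<phi> (W - \<sigma>))"
      by (intro poly_mapping_eqI) (simp add: lookup_sum lookup_single when_def cobd_def sum_distrib_left)
    finally show ?thesis
      using True by (simp add: koszul_of_def)
  qed
qed

lemma cochain_of_koszul_of: "\<tau> \<subseteq> W \<Longrightarrow> cochain_of W (koszul_of W \<phi>) \<tau> = \<phi> \<tau>"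
  by (simp add: cochain_of_def koszul_of_def double_diff)

lemma homogeneous_koszul_of:
  assumes "\<And>\<tau>. card \<tau> \<noteq> n \<Longrightarrow> \<phi> \<tau> = 0" and "card W = q + n"
  shows "homogeneous q 0 (q + n) (koszul_of W \<phi>)"
  unfolding homogeneous_def
proof (intro allI impI)
  fix \<sigma> m assume "Poly_Mapping.lookup (koszul_of W \<phi> \<sigma>) m \<noteq> 0"
  then have *: "\<sigma> \<subseteq> W" "m = set_exp (W - \<sigma>)" "\<phi> (W - \<sigma>) \<noteq> 0"
    by (auto simp: koszul_of_def lookup_single when_def split: if_splits)
  then have "card (W - \<sigma>) = n"
    using assms(1) by blast
  then show "card \<sigma> = q \<and> monom_deg m + q + 0 = q + n"
    using * assms(2) by (simp add: card_Diff_subset) (metis add_diff_cancel_right' card_mono finite le_add_diff_inverse add_right_cancel)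
qed

text \<open>Representatives over \<open>R\<close> of the cycles and boundaries of the Koszul complex of \<open>R / I\<close>.\<close>

definition koszul_cycle :: "'v::finite set set \<Rightarrow> nat \<Rightarrow> nat \<Rightarrow> ('v set \<Rightarrow> ('v, 'k::comm_ring_1) mpoly) \<Rightarrow> bool" where
  "koszul_cycle E q j z \<longleftrightarrow> homogeneous q 0 j z \<and> (\<forall>\<sigma>. koszul z \<sigma> \<in> edge_ideal E)"

definition koszul_boundary :: "'v::finite set set \<Rightarrow> nat \<Rightarrow> nat \<Rightarrow> ('v set \<Rightarrow> ('v, 'k::comm_ring_1) mpoly) \<Rightarrow> bool" where
  "koszul_boundary E q j z \<longleftrightarrow> (\<exists>y. homogeneous (Suc q) 0 j y \<and> (\<forall>\<sigma>. z \<sigma> - koszul y \<sigma> \<in> edge_ideal E))"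

text \<open>One half of Hochster's formula: \<open>koszul_of\<close> places the cocycle in
  multidegree \<open>W\<close>, where non-faces contribute only terms of the ideal. Were the result
  a boundary, \<open>cochain_of\<close> would turn its preimage into a primitive of
  \<open>\<phi>\<close>.\<close>

lemma nontrivial_koszul_cycle:
  fixes \<phi> :: "'v::finite set \<Rightarrow> 'k::comm_ring_1"
  assumes E: "simple_graph E" and \<phi>: "nontrivial E n W \<phi>" and W: "card W = q + n"
  obtains z :: "'v set \<Rightarrow> ('v, 'k) mpoly" where "koszul_cycle E q (q + n) z" "\<not> koszul_boundary E q (q + n) z"
proof -
  \<comment> \<open>The values of \<open>\<phi>\<close> on sets of other sizes are arbitrary and
    would spoil homogeneity.\<close>
  define \<phi>' where "\<phi>' \<tau> = (if card \<tau> = n then \<phi> \<tau> else 0)" for \<tau>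
  define z where "z = koszul_of W \<phi>'"
  have cob0: "cobd \<phi>' \<tau> = 0" if \<tau>: "\<tau> \<subseteq> W" "face E \<tau>" for \<tau>
  proof (cases "card \<tau> = Suc n")
    case True
    then have "cobd \<phi>' \<tau> = cobd \<phi> \<tau>"
      by (intro cobd_cong) (simp add: \<phi>'_def)
    then show ?thesis
      using \<phi> \<tau> True by (auto simp: nontrivial_def cocycle_def)
  next
    case False
    have "card (\<tau> - {v}) \<noteq> n" if "v \<in> \<tau>" for v
      using False card_Suc_Diff1[of \<tau> v] that by auto
    then show ?thesis
      by (auto simp: cobd_def \<phi>'_def intro!: sum.neutral)
  qed
  have "homogeneous q 0 (q + n) z"
    unfolding z_def using W by (intro homogeneous_koszul_of) (auto simp: \<phi>'_def)
  moreover have "koszul z \<sigma> \<in> edge_ideal E" for \<sigma>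
    unfolding mem_edge_ideal_iff[OF E] z_def koszul_koszul_of
    by (auto simp: koszul_of_def lookup_single when_def cob0)
  ultimately have "koszul_cycle E q (q + n) z"
    by (simp add: koszul_cycle_def)
  moreover have "\<not> koszul_boundary E q (q + n) z"
  proof
    assume "koszul_boundary E q (q + n) z"
    then obtain y where y: "\<And>\<sigma>. z \<sigma> - koszul y \<sigma> \<in> edge_ideal E"
      by (auto simp: koszul_boundary_def)
    have "\<phi> \<tau> = cobd (cochain_of W y) \<tau>" if \<tau>: "\<tau> \<subseteq> W" "face E \<tau>" "card \<tau> = n" for \<tau>
    proof -
      have "Poly_Mapping.lookup (z (W - \<tau>) - koszul y (W - \<tau>)) (set_exp \<tau>) = 0"
        using y[of "W - \<tau>"] \<tau>(2) by (simp add: mem_edge_ideal_iff[OF E])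
      then have "cochain_of W z \<tau> = cochain_of W (koszul y) \<tau>"
        by (simp add: cochain_of_def lookup_minus)
      then show ?thesis
        using \<tau> by (simp add: z_def cochain_of_koszul_of cobd_cochain_of \<phi>'_def)
    qed
    then show False
      using \<phi> by (auto simp: nontrivial_def coboundary_def)
  qed
  ultimately show thesis
    by (rule that)
qed

text \<open>Where some exponent of the multidegree is at least 2, the homotopy at that variable
  respects the ideal, so only squarefree multidegrees can obstruct.\<close>

lemma koszul_boundaryI_squarefree:
  fixes z :: "'v::finite set \<Rightarrow> ('v, 'k::comm_ring_1) mpoly"
  assumes E: "simple_graph E" and z: "koszul_cycle E q j z"
    and sqfree: "\<And>\<sigma> \<tau>. face E \<tau> \<Longrightarrow> \<sigma> \<inter> \<tau> = {} \<Longrightarrow> Poly_Mapping.lookup (z \<sigma>) (set_exp \<tau>) = 0"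
  shows "koszul_boundary E q j z"
proof -
  define c where "c b = (if \<exists>v. 2 \<le> Poly_Mapping.lookup b v then Some (SOME v. 2 \<le> Poly_Mapping.lookup b v) else None)"
    for b :: "'v \<Rightarrow>\<^sub>0 nat"
  have c: "2 \<le> Poly_Mapping.lookup b v" if "c b = Some v" for b v
  proof -
    have "\<exists>v. 2 \<le> Poly_Mapping.lookup b v"
      using that by (auto simp: c_def split: if_splits)
    then have "2 \<le> Poly_Mapping.lookup b (SOME v. 2 \<le> Poly_Mapping.lookup b v)"
      by (rule someI_ex)
    then show ?thesis
      using that by (auto simp: c_def split: if_splits)
  qed
  have "z \<sigma> - koszul (homotopy c z) \<sigma> \<in> edge_ideal E" for \<sigma>
    unfolding mem_edge_ideal_iff[OF E]
  proof (intro allI impI)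
    fix m :: "'v \<Rightarrow>\<^sub>0 nat" assume m: "face E (Poly_Mapping.keys m)"
    have "Poly_Mapping.lookup (z \<sigma>) m = Poly_Mapping.lookup (koszul (homotopy c z) \<sigma>) m"
    proof (cases "c (m + set_exp \<sigma>)")
      case None
      then have lt: "Poly_Mapping.lookup (m + set_exp \<sigma>) v < 2" for v
        by (auto simp: c_def not_le split: if_splits)
      define W where "W = Poly_Mapping.keys (m + set_exp \<sigma>)"
      have "m + set_exp \<sigma> = set_exp W"
        unfolding W_def by (rule squarefree_eq_set_exp) (rule lt)
      then have mW: "m = set_exp (W - \<sigma>)"
        by (simp add: add_set_exp_eq_iff)
      have "Poly_Mapping.lookup (z \<sigma>) (set_exp (W - \<sigma>)) = 0"
        using m by (intro sqfree) (auto simp: mW)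
      then show ?thesis
        using lookup_koszul_homotopy_None[of c m \<sigma> z, OF None] by (simp flip: mW)
    next
      case (Some v)
      have "Poly_Mapping.lookup (homotopy c (koszul z) \<sigma>) m = 0"
      proof (cases "v \<in> \<sigma>")
        case True
        then have "Poly_Mapping.lookup m v \<noteq> 0"
          using c[OF Some] by (auto simp: lookup_add lookup_set_exp)
        \<comment> \<open>The exterior part accounts for only one of the two units at
          \<open>v\<close>, so \<open>m\<close> already contains \<open>v\<close> and the shift
          leaves its support unchanged.\<close>
        then have "Poly_Mapping.keys (m + unit_exp v) = Poly_Mapping.keys m"
          by (auto simp: in_keys_iff lookup_add lookup_unit_exp split: if_splits)
        then have "Poly_Mapping.lookup (koszul z (\<sigma> - {v})) (m + unit_exp v) = 0"
          using m z by (simp add: koszul_cycle_def mem_edge_ideal_iff[OF E])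
        then show ?thesis
          by (simp add: lookup_homotopy Some)
      qed (simp add: lookup_homotopy Some)
      moreover have "Poly_Mapping.lookup (m + set_exp \<sigma>) v \<noteq> 0"
        using c[OF Some] by auto
      ultimately show ?thesis
        using koszul_homotopy[of c m \<sigma> v z] Some by simp
    qed
    then show "Poly_Mapping.lookup (z \<sigma> - koszul (homotopy c z) \<sigma>) m = 0"
      by (simp add: lookup_minus)
  qed
  moreover have "homogeneous (Suc q) 0 j (homotopy c z)"
    using z by (intro homogeneous_homotopy) (simp add: koszul_cycle_def)
  ultimately show ?thesis
    unfolding koszul_boundary_def by blast
qed

text \<open>The other half of Hochster's formula. If every cocycle of this size were a coboundary,
  correcting \<open>z\<close> by primitives in all squarefree multidegrees at once would leave a
  cycle to which \<open>koszul_boundaryI_squarefree\<close> applies.\<close>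

lemma koszul_cycle_nontrivial:
  fixes z :: "'v::finite set \<Rightarrow> ('v, 'k::comm_ring_1) mpoly"
  assumes E: "simple_graph E" and z: "koszul_cycle E q (q + Suc n) z" and nb: "\<not> koszul_boundary E q (q + Suc n) z"
  shows "\<exists>W \<phi>. card W = q + Suc n \<and> nontrivial E (Suc n) W (\<phi> :: 'v set \<Rightarrow> 'k)"
proof (rule ccontr)
  assume none: "\<not> ?thesis"
  define \<W> where "\<W> = {W :: 'v set. card W = q + Suc n}"
  have hom: "homogeneous q 0 (q + Suc n) z"
    using z by (simp add: koszul_cycle_def)
  have "\<exists>\<psi>. \<forall>\<tau>\<subseteq>W. face E \<tau> \<longrightarrow> card \<tau> = Suc n \<longrightarrow> cochain_of W z \<tau> = cobd \<psi> \<tau>" if "W \<in> \<W>" for W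
  proof -
    have "cobd (cochain_of W z) \<tau> = 0" if "\<tau> \<subseteq> W" "face E \<tau>" for \<tau>
      using that z by (simp add: cobd_cochain_of koszul_cycle_def mem_edge_ideal_iff[OF E] cochain_of_def)
    then have "cocycle E (Suc n) W (cochain_of W z)"
      by (simp add: cocycle_def)
    then have "coboundary E (Suc n) W (cochain_of W z)"
      using none that by (auto simp: \<W>_def nontrivial_def)
    then show ?thesis
      by (simp add: coboundary_def)
  qed
  then obtain \<psi> where \<psi>: "\<And>W \<tau>. W \<in> \<W> \<Longrightarrow> \<tau> \<subseteq> W \<Longrightarrow> face E \<tau> \<Longrightarrow> card \<tau> = Suc n \<Longrightarrow>
      cochain_of W z \<tau> = cobd (\<psi> W) \<tau>"
    by metis
  define \<psi>' where "\<psi>' W \<tau> = (if card \<tau> = n then \<psi> W \<tau> else 0)" for W \<tau>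
  define y where "y \<sigma> = (\<Sum>W\<in>\<W>. koszul_of W (\<psi>' W) \<sigma>)" for \<sigma>
  have cob': "cobd (\<psi>' W) \<tau> = (if card \<tau> = Suc n then cobd (\<psi> W) \<tau> else 0)" for W \<tau>
  proof (cases "card \<tau> = Suc n")
    case True
    then show ?thesis
      by (auto simp: \<psi>'_def intro!: cobd_cong)
  next
    case False
    have "card (\<tau> - {v}) \<noteq> n" if "v \<in> \<tau>" for v
      using False card_Suc_Diff1[of \<tau> v] that by auto
    then show ?thesis
      using False by (auto simp: cobd_def \<psi>'_def intro!: sum.neutral)
  qed
  have "homogeneous (Suc q) 0 (Suc q + n) (koszul_of W (\<psi>' W))" if "W \<in> \<W>" for W
    using that by (intro homogeneous_koszul_of) (auto simp: \<psi>'_def \<W>_def)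
  then have homy: "homogeneous (Suc q) 0 (q + Suc n) y"
    unfolding y_def[abs_def] by (intro homogeneous_sum) simp
  have ky: "koszul y \<sigma> = (\<Sum>W\<in>\<W>. koszul_of W (cobd (\<psi>' W)) \<sigma>)" for \<sigma>
    unfolding y_def[abs_def] by (simp add: koszul_sum koszul_koszul_of)
  define z' where "z' \<sigma> = z \<sigma> - koszul y \<sigma>" for \<sigma>
  have "homogeneous q 0 (q + Suc n) z'"
    unfolding z'_def[abs_def] using hom homogeneous_koszul[OF homy] by (intro homogeneous_diff) auto
  moreover have "koszul z' \<sigma> = koszul z \<sigma>" for \<sigma>
    unfolding z'_def[abs_def] by (simp add: koszul_diff)
  ultimately have z': "koszul_cycle E q (q + Suc n) z'"
    using z by (simp add: koszul_cycle_def)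
  have "Poly_Mapping.lookup (z' \<sigma>) (set_exp \<tau>) = 0" if \<tau>: "face E \<tau>" "\<sigma> \<inter> \<tau> = {}" for \<sigma> \<tau>
  proof -
    define W where "W = \<sigma> \<union> \<tau>"
    have W: "\<sigma> \<subseteq> W" "\<tau> = W - \<sigma>" "\<sigma> = W - \<tau>" "\<tau> \<subseteq> W"
      using \<tau> by (auto simp: W_def)
    have cardW: "card W = card \<sigma> + card \<tau>"
      using \<tau> by (simp add: W_def card_Un_disjoint)
    have "Poly_Mapping.lookup (koszul y \<sigma>) (set_exp \<tau>) = (\<Sum>V\<in>\<W>. if V = W then star_sign W \<sigma> * cobd (\<psi>' W) \<tau> else 0)"
      unfolding ky lookup_sum
    proof (rule sum.cong)
      fix V
      \<comment> \<open>The exterior part and the monomial together determine the multidegree, so a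
        single summand contributes.\<close>
      have "\<sigma> \<subseteq> V \<and> \<tau> = V - \<sigma> \<longleftrightarrow> V = W"
        using \<tau>(2) by (auto simp: W_def)
      then show "Poly_Mapping.lookup (koszul_of V (cobd (\<psi>' V)) \<sigma>) (set_exp \<tau>)
          = (if V = W then star_sign W \<sigma> * cobd (\<psi>' W) \<tau> else 0)"
        by (auto simp: koszul_of_def lookup_single when_def)
    qed simp
    also have "\<dots> = (if W \<in> \<W> then star_sign W \<sigma> * cobd (\<psi>' W) \<tau> else 0)"
      by simp
    also have "\<dots> = Poly_Mapping.lookup (z \<sigma>) (set_exp \<tau>)"
    proof (cases "card \<sigma> = q \<and> card \<tau> = Suc n")
      case True
      then have "W \<in> \<W>"
        using cardW by (simp add: \<W>_def)
      moreover have "cobd (\<psi>' W) \<tau> = cochain_of W z \<tau>"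
        using True \<psi>[OF \<open>W \<in> \<W>\<close> W(4) \<tau>(1)] by (simp add: cob')
      ultimately show ?thesis
        by (simp add: cochain_of_def flip: W(3))
    next
      case False
      have "Poly_Mapping.lookup (z \<sigma>) (set_exp \<tau>) = 0"
      proof (rule ccontr)
        assume "Poly_Mapping.lookup (z \<sigma>) (set_exp \<tau>) \<noteq> 0"
        then have "card \<sigma> = q \<and> monom_deg (set_exp \<tau>) + q + 0 = q + Suc n"
          using hom unfolding homogeneous_def by blast
        then show False
          using False by simp
      qed
      moreover have "card \<tau> \<noteq> Suc n" if "W \<in> \<W>"
        using that False cardW by (auto simp: \<W>_def)
      ultimately show ?thesis
        by (auto simp: cob')
    qed
    finally show ?thesis
      by (simp add: z'_def lookup_minus)
  qed
  then have "koszul_boundary E q (q + Suc n) z'"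
    using koszul_boundaryI_squarefree[OF E z'] by blast
  then obtain x where x: "homogeneous (Suc q) 0 (q + Suc n) x" "\<And>\<sigma>. z' \<sigma> - koszul x \<sigma> \<in> edge_ideal E"
    by (auto simp: koszul_boundary_def)
  have "koszul_boundary E q (q + Suc n) z"
    unfolding koszul_boundary_def
    using homogeneous_add[OF homy x(1)] x(2)
    by (intro exI[of _ "\<lambda>\<sigma>. y \<sigma> + x \<sigma>"]) (simp add: koszul_add z'_def diff_diff_eq)
  then show False
    using nb by simp
qed

section \<open>The double complex of a resolution\<close>

definition restrict_poly :: "('m \<Rightarrow> bool) \<Rightarrow> ('m \<Rightarrow>\<^sub>0 'k::zero) \<Rightarrow> 'm \<Rightarrow>\<^sub>0 'k" where
  "restrict_poly P p = Abs_poly_mapping (\<lambda>m. if P m then Poly_Mapping.lookup p m else 0)"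

lemma lookup_restrict_poly:
  "Poly_Mapping.lookup (restrict_poly P p) m = (if P m then Poly_Mapping.lookup p m else 0)"
proof -
  have "finite {m. (if P m then Poly_Mapping.lookup p m else 0) \<noteq> 0}"
    by (rule finite_subset[of _ "Poly_Mapping.keys p"]) (auto simp: in_keys_iff)
  then show ?thesis
    by (simp add: restrict_poly_def)
qed

lemma restrict_poly_sum: "restrict_poly P (\<Sum>i\<in>A. f i) = (\<Sum>i\<in>A. restrict_poly P (f i))"
  by (intro poly_mapping_eqI) (simp add: lookup_restrict_poly lookup_sum)

text \<open>Multiplication by a homogeneous \<open>a\<close> shifts degrees and hence commutes with
  taking components; \<open>P\<close> and \<open>Q\<close> are to be read as degree conditions after
  and before the shift.\<close>

lemma restrict_poly_mult:
  fixes a w :: "('m::monoid_add \<Rightarrow>\<^sub>0 'k::comm_semiring_1)"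
  assumes PQ: "\<And>m1 m2. m1 \<in> Poly_Mapping.keys a \<Longrightarrow> P (m1 + m2) \<longleftrightarrow> Q m2"
  shows "restrict_poly P (a * w) = a * restrict_poly Q w"
proof -
  have w: "w = restrict_poly Q w + restrict_poly (\<lambda>m. \<not> Q m) w"
    by (intro poly_mapping_eqI) (simp add: lookup_add lookup_restrict_poly)
  have kP: "P m" if m: "m \<in> Poly_Mapping.keys (a * restrict_poly Q w)" for m
  proof -
    obtain m1 m2 where "m = m1 + m2" "m1 \<in> Poly_Mapping.keys a" "m2 \<in> Poly_Mapping.keys (restrict_poly Q w)"
      using m keys_mult[of a "restrict_poly Q w"] by blast
    then show ?thesis
      using PQ by (auto simp: in_keys_iff lookup_restrict_poly split: if_splits)
  qed
  have kN: "\<not> P m" if m: "m \<in> Poly_Mapping.keys (a * restrict_poly (\<lambda>m. \<not> Q m) w)" for m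
  proof -
    obtain m1 m2 where "m = m1 + m2" "m1 \<in> Poly_Mapping.keys a" "m2 \<in> Poly_Mapping.keys (restrict_poly (\<lambda>m. \<not> Q m) w)"
      using m keys_mult[of a "restrict_poly (\<lambda>m. \<not> Q m) w"] by blast
    then show ?thesis
      using PQ by (auto simp: in_keys_iff lookup_restrict_poly split: if_splits)
  qed
  show ?thesis
  proof (rule poly_mapping_eqI)
    fix m
    have "Poly_Mapping.lookup (a * w) m = Poly_Mapping.lookup (a * restrict_poly Q w) m
        + Poly_Mapping.lookup (a * restrict_poly (\<lambda>m. \<not> Q m) w) m"
      by (subst w) (simp add: distrib_left lookup_add)
    moreover have "Poly_Mapping.lookup (a * restrict_poly (\<lambda>m. \<not> Q m) w) m = 0" if "P m"
      using kN[of m] that by (meson in_keys_iff)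
    moreover have "Poly_Mapping.lookup (a * restrict_poly Q w) m = 0" if "\<not> P m"
      using kP[of m] that by (meson in_keys_iff)
    ultimately show "Poly_Mapping.lookup (restrict_poly P (a * w)) m = Poly_Mapping.lookup (a * restrict_poly Q w) m"
      by (simp add: lookup_restrict_poly)
  qed
qed

lemma homogeneous_mult:
  fixes a :: "('v::finite, 'k::comm_ring_1) mpoly"
  assumes a: "\<And>m. m \<in> Poly_Mapping.keys a \<Longrightarrow> monom_deg m + t = t'" and z: "homogeneous q t' j z"
  shows "homogeneous q t j (\<lambda>\<sigma>. a * z \<sigma>)"
  unfolding homogeneous_def
proof (intro allI impI)
  fix \<sigma> m assume "Poly_Mapping.lookup (a * z \<sigma>) m \<noteq> 0"
  then have "m \<in> Poly_Mapping.keys (a * z \<sigma>)"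
    by (simp add: in_keys_iff)
  then obtain m1 m2 where m: "m = m1 + m2" "m1 \<in> Poly_Mapping.keys a" "m2 \<in> Poly_Mapping.keys (z \<sigma>)"
    using keys_mult[of a "z \<sigma>"] by blast
  then have "card \<sigma> = q \<and> monom_deg m2 + q + t' = j"
    using z by (auto simp: homogeneous_def in_keys_iff)
  then show "card \<sigma> = q \<and> monom_deg m + q + t = j"
    using a[OF m(2)] by (simp add: m(1) monom_deg_add)
qed

lemma lookup_mult_const_0:
  fixes a w :: "('v, 'k::comm_ring_1) mpoly"
  assumes "Poly_Mapping.lookup a 0 = 0"
  shows "Poly_Mapping.lookup (a * w) 0 = 0"
proof (rule ccontr)
  assume "Poly_Mapping.lookup (a * w) 0 \<noteq> 0"
  then have "0 \<in> Poly_Mapping.keys (a * w)"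
    by (simp add: in_keys_iff)
  then obtain m1 m2 where m: "0 = m1 + m2" "m1 \<in> Poly_Mapping.keys a"
    using keys_mult[of a w] by blast
  have "m1 = 0"
  proof (rule poly_mapping_eqI)
    fix v show "Poly_Mapping.lookup m1 v = Poly_Mapping.lookup 0 v"
      using arg_cong[OF m(1), of "\<lambda>m. Poly_Mapping.lookup m v"] by (simp add: lookup_add)
  qed
  then show False
    using m(2) assms by (simp add: in_keys_iff)
qed

lemma sum_minus_distrib_mult:
  fixes a :: "'i \<Rightarrow> 'r::comm_ring_1"
  shows "(\<Sum>i\<in>S. a i * (x i - y i)) = (\<Sum>i\<in>S. a i * x i) - (\<Sum>i\<in>S. a i * y i)"
  by (simp add: right_diff_distrib sum_subtractf)

text \<open>\<open>cell p q\<close> is the part of total degree \<open>j\<close> of the term \<open>F\<^sub>p \<otimes> K\<^sub>q\<close> of the double complex of the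
  resolution and the Koszul complex, and \<open>res_diff\<close>, \<open>kos_diff\<close> are its two differentials; they commute,
  without a sign. Here \<open>z b \<sigma>\<close> is the coefficient of the \<open>b\<close>-th basis element of \<open>F\<^sub>p\<close> times
  \<open>e\<^sub>\<sigma>\<close>.\<close>

locale graded_resolution =
  fixes E :: "'v::finite set set" and s :: "nat \<Rightarrow> nat list" and A :: "nat \<Rightarrow> ('v, 'k::field) mpoly mat"
    and j :: nat
  assumes E: "simple_graph E"
    and res: "minimal_graded_free_resolution (edge_ideal E :: ('v, 'k) mpoly set) s A"
begin

section \<open>The resolution in terms of index functions\<close>

lemma s_0: "s 0 = [0]"
  using res by (simp add: minimal_graded_free_resolution_def)

lemma A_carrier: "A p \<in> carrier_mat (length (s p)) (length (s (Suc p)))"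
  using res by (simp add: minimal_graded_free_resolution_def)

lemma A_degree:
  "b < length (s p) \<Longrightarrow> c < length (s (Suc p)) \<Longrightarrow> m \<in> Poly_Mapping.keys (A p $$ (b, c)) \<Longrightarrow>
    monom_deg m + s p ! b = s (Suc p) ! c"
  using res by (simp add: minimal_graded_free_resolution_def)

lemma A_minimal:
  "b < length (s p) \<Longrightarrow> c < length (s (Suc p)) \<Longrightarrow> Poly_Mapping.lookup (A p $$ (b, c)) 0 = 0"
  using res by (simp add: minimal_graded_free_resolution_def)

text \<open>Column vectors become plain functions of the index; values beyond the rank are
  ignored.\<close>

definition in_image :: "nat \<Rightarrow> (nat \<Rightarrow> ('v, 'k) mpoly) \<Rightarrow> bool" where
  "in_image p f \<longleftrightarrow> (\<exists>w. \<forall>b<length (s p). f b = (\<Sum>c<length (s (Suc p)). A p $$ (b, c) * w c))"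

lemma A_mult_vec:
  assumes "b < length (s p)" "v \<in> carrier_vec (length (s (Suc p)))"
  shows "(A p *\<^sub>v v) $ b = (\<Sum>c<length (s (Suc p)). A p $$ (b, c) * v $ c)"
  using assms A_carrier[of p] by (simp add: scalar_prod_def lessThan_atLeast0)

lemma in_image_iff:
  "in_image p f \<longleftrightarrow> vec (length (s p)) f \<in> (\<lambda>v. A p *\<^sub>v v) ` carrier_vec (length (s (Suc p)))"
proof
  assume "in_image p f"
  then obtain w where w: "\<And>b. b < length (s p) \<Longrightarrow> f b = (\<Sum>c<length (s (Suc p)). A p $$ (b, c) * w c)"
    by (auto simp: in_image_def)
  have "vec (length (s p)) f = A p *\<^sub>v vec (length (s (Suc p))) w"
  proof (rule eq_vecI)
    fix b assume "b < dim_vec (A p *\<^sub>v vec (length (s (Suc p))) w)"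
    then have b: "b < length (s p)"
      using A_carrier[of p] by simp
    then show "vec (length (s p)) f $ b = (A p *\<^sub>v vec (length (s (Suc p))) w) $ b"
      by (simp add: A_mult_vec w del: index_mult_mat_vec)
  qed (use A_carrier[of p] in simp)
  then show "vec (length (s p)) f \<in> (\<lambda>v. A p *\<^sub>v v) ` carrier_vec (length (s (Suc p)))"
    by (rule image_eqI) simp
next
  assume "vec (length (s p)) f \<in> (\<lambda>v. A p *\<^sub>v v) ` carrier_vec (length (s (Suc p)))"
  then obtain v where v: "v \<in> carrier_vec (length (s (Suc p)))" "vec (length (s p)) f = A p *\<^sub>v v"
    by blast
  have "f b = (\<Sum>c<length (s (Suc p)). A p $$ (b, c) * v $ c)" if "b < length (s p)" for b
    using arg_cong[OF v(2), of "\<lambda>x. x $ b"] that A_mult_vec[OF that v(1)] by simp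
  then show "in_image p f"
    by (auto simp: in_image_def intro!: exI[of _ "\<lambda>c. v $ c"])
qed

lemma in_image_0_iff: "in_image 0 f \<longleftrightarrow> f 0 \<in> edge_ideal E"
proof -
  have "(\<lambda>v. A 0 *\<^sub>v v) ` carrier_vec (length (s 1)) = {w \<in> carrier_vec 1. w $ 0 \<in> edge_ideal E}"
    using res by (simp add: minimal_graded_free_resolution_def)
  then show ?thesis
    by (simp add: in_image_iff s_0)
qed

lemma in_image_Suc_iff:
  "in_image (Suc p) f \<longleftrightarrow> (\<forall>b<length (s p). (\<Sum>c<length (s (Suc p)). A p $$ (b, c) * f c) = 0)"
proof -
  have "(\<lambda>v. A (Suc p) *\<^sub>v v) ` carrier_vec (length (s (Suc (Suc p)))) = mat_kernel (A p)"
    using res by (simp add: minimal_graded_free_resolution_def)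
  then have "in_image (Suc p) f \<longleftrightarrow> A p *\<^sub>v vec (length (s (Suc p))) f = 0\<^sub>v (length (s p))"
    by (simp add: in_image_iff mat_kernel[OF A_carrier])
  also have "\<dots> \<longleftrightarrow> (\<forall>b<length (s p). (A p *\<^sub>v vec (length (s (Suc p))) f) $ b = 0)"
    using A_carrier[of p] by (auto simp: vec_eq_iff simp del: index_mult_mat_vec)
  also have "\<dots> \<longleftrightarrow> (\<forall>b<length (s p). (\<Sum>c<length (s (Suc p)). A p $$ (b, c) * f c) = 0)"
    by (simp add: A_mult_vec del: index_mult_mat_vec)
  finally show ?thesis .
qed

definition cell :: "nat \<Rightarrow> nat \<Rightarrow> (nat \<Rightarrow> 'v set \<Rightarrow> ('v, 'k) mpoly) \<Rightarrow> bool" where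
  "cell p q z \<longleftrightarrow> (\<forall>b. if b < length (s p) then homogeneous q (s p ! b) j (z b) else z b = (\<lambda>\<sigma>. 0))"

definition res_diff :: "nat \<Rightarrow> (nat \<Rightarrow> 'v set \<Rightarrow> ('v, 'k) mpoly) \<Rightarrow> nat \<Rightarrow> 'v set \<Rightarrow> ('v, 'k) mpoly" where
  "res_diff p z b \<sigma> = (if b < length (s p) then \<Sum>c<length (s (Suc p)). A p $$ (b, c) * z c \<sigma> else 0)"

definition kos_diff :: "(nat \<Rightarrow> 'v set \<Rightarrow> ('v, 'k) mpoly) \<Rightarrow> nat \<Rightarrow> 'v set \<Rightarrow> ('v, 'k) mpoly" where
  "kos_diff z b = koszul (z b)"

lemma res_diff_add: "res_diff p (\<lambda>b \<sigma>. x b \<sigma> + y b \<sigma>) = (\<lambda>b \<sigma>. res_diff p x b \<sigma> + res_diff p y b \<sigma>)"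
  by (simp add: res_diff_def fun_eq_iff distrib_left sum.distrib)

lemma res_diff_diff: "res_diff p (\<lambda>b \<sigma>. x b \<sigma> - y b \<sigma>) = (\<lambda>b \<sigma>. res_diff p x b \<sigma> - res_diff p y b \<sigma>)"
  by (simp add: res_diff_def fun_eq_iff sum_minus_distrib_mult)

lemma res_diff_zero [simp]: "res_diff p (\<lambda>b \<sigma>. 0) = (\<lambda>b \<sigma>. 0)"
  by (simp add: res_diff_def fun_eq_iff)

lemma kos_diff_add: "kos_diff (\<lambda>b \<sigma>. x b \<sigma> + y b \<sigma>) = (\<lambda>b \<sigma>. kos_diff x b \<sigma> + kos_diff y b \<sigma>)"
  by (simp add: kos_diff_def fun_eq_iff koszul_add)

lemma kos_diff_diff: "kos_diff (\<lambda>b \<sigma>. x b \<sigma> - y b \<sigma>) = (\<lambda>b \<sigma>. kos_diff x b \<sigma> - kos_diff y b \<sigma>)"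
  by (simp add: kos_diff_def fun_eq_iff koszul_diff)

lemma kos_diff_kos_diff [simp]: "kos_diff (kos_diff z) = (\<lambda>b \<sigma>. 0)"
proof (intro ext)
  fix b \<sigma>
  have "kos_diff z b = koszul (z b)"
    by (simp add: kos_diff_def fun_eq_iff)
  then show "kos_diff (kos_diff z) b \<sigma> = 0"
    by (simp add: kos_diff_def)
qed

lemma kos_diff_res_diff: "kos_diff (res_diff p z) = res_diff p (kos_diff z)"
proof (intro ext)
  fix b \<sigma>
  show "kos_diff (res_diff p z) b \<sigma> = res_diff p (kos_diff z) b \<sigma>"
  proof (cases "b < length (s p)")
    case True
    then have "res_diff p z b = (\<lambda>\<sigma>. \<Sum>c<length (s (Suc p)). A p $$ (b, c) * z c \<sigma>)"
      by (simp add: res_diff_def fun_eq_iff)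
    then have "kos_diff (res_diff p z) b \<sigma> = (\<Sum>c<length (s (Suc p)). koszul (\<lambda>\<sigma>. A p $$ (b, c) * z c \<sigma>) \<sigma>)"
      by (simp add: kos_diff_def koszul_sum)
    also have "\<dots> = res_diff p (kos_diff z) b \<sigma>"
      using True by (simp add: koszul_mult res_diff_def kos_diff_def)
    finally show ?thesis .
  next
    case False
    then have "res_diff p z b = (\<lambda>\<sigma>. 0)"
      by (simp add: res_diff_def fun_eq_iff)
    then show ?thesis
      using False by (simp add: kos_diff_def res_diff_def koszul_def)
  qed
qed

lemma res_diff_res_diff [simp]: "res_diff p (res_diff (Suc p) z) = (\<lambda>b \<sigma>. 0)"
proof (intro ext)
  fix b \<sigma>
  have "in_image (Suc p) (\<lambda>c. res_diff (Suc p) z c \<sigma>)"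
    by (auto simp: in_image_def res_diff_def intro!: exI[of _ "\<lambda>c. z c \<sigma>"])
  then show "res_diff p (res_diff (Suc p) z) b \<sigma> = 0"
    by (simp add: in_image_Suc_iff res_diff_def[of p])
qed

lemma cell_zero [simp]: "cell p q (\<lambda>b \<sigma>. 0)"
  by (simp add: cell_def)

lemma cell_diff: "cell p q x \<Longrightarrow> cell p q y \<Longrightarrow> cell p q (\<lambda>b \<sigma>. x b \<sigma> - y b \<sigma>)"
  by (auto simp: cell_def intro: homogeneous_diff)

lemma cell_res_diff:
  assumes "cell (Suc p) q z"
  shows "cell p q (res_diff p z)"
  unfolding cell_def
proof (intro allI)
  fix b
  show "if b < length (s p) then homogeneous q (s p ! b) j (res_diff p z b) else res_diff p z b = (\<lambda>\<sigma>. 0)"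
  proof (cases "b < length (s p)")
    case True
    have "homogeneous q (s p ! b) j (\<lambda>\<sigma>. \<Sum>c<length (s (Suc p)). A p $$ (b, c) * z c \<sigma>)"
    proof (rule homogeneous_sum)
      fix c assume "c \<in> {..<length (s (Suc p))}"
      then show "homogeneous q (s p ! b) j (\<lambda>\<sigma>. A p $$ (b, c) * z c \<sigma>)"
        using assms True A_degree[of b p c]
        by (intro homogeneous_mult[where t' = "s (Suc p) ! c"]) (auto simp: cell_def split: if_splits)
    qed
    then show ?thesis
      using True by (simp add: res_diff_def[abs_def])
  qed (simp add: res_diff_def fun_eq_iff)
qed

lemma cell_kos_diff:
  assumes "cell p q z"
  shows "cell p (q - 1) (kos_diff z)"
  unfolding cell_def
proof (intro allI)
  fix b
  have v: "kos_diff z b = koszul (z b)"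
    by (simp add: kos_diff_def fun_eq_iff)
  show "if b < length (s p) then homogeneous (q - 1) (s p ! b) j (kos_diff z b) else kos_diff z b = (\<lambda>\<sigma>. 0)"
    using assms homogeneous_koszul[of q "s p ! b" j "z b"]
    by (auto simp: cell_def v koszul_def fun_eq_iff split: if_splits)
qed

lemma cell_outside: "cell p q z \<Longrightarrow> \<not> b < length (s p) \<Longrightarrow> z b \<sigma> = 0"
  by (simp add: cell_def)

lemma cell_wrong_card:
  assumes "cell p q z" "card \<sigma> \<noteq> q"
  shows "z b \<sigma> = 0"
proof (cases "b < length (s p)")
  case True
  then have "homogeneous q (s p ! b) j (z b)"
    using assms by (auto simp: cell_def)
  then show ?thesis
    using assms(2) by (intro poly_mapping_eqI) (auto simp: homogeneous_def)
qed (use assms in \<open>simp add: cell_def\<close>)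

text \<open>Exactness gives a preimage for each \<open>\<sigma>\<close> separately, possibly
  inhomogeneous. The matrix entries are homogeneous, so its component of the right degree is still a
  preimage.\<close>

lemma lift_res_diff:
  assumes z: "cell p q z" and im: "\<And>\<sigma>. in_image p (\<lambda>b. z b \<sigma>)"
  obtains y where "cell (Suc p) q y" "z = res_diff p y"
proof -
  obtain w where w: "\<And>\<sigma> b. b < length (s p) \<Longrightarrow> z b \<sigma> = (\<Sum>c<length (s (Suc p)). A p $$ (b, c) * w \<sigma> c)"
    using im unfolding in_image_def by metis
  define Q where "Q t m \<longleftrightarrow> monom_deg m + q + t = j" for t and m :: "'v \<Rightarrow>\<^sub>0 nat"
  define y where "y c \<sigma> = (if c < length (s (Suc p)) \<and> card \<sigma> = q
    then restrict_poly (Q (s (Suc p) ! c)) (w \<sigma> c) else 0)" for c \<sigma>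
  have "cell (Suc p) q y"
    by (auto simp: cell_def homogeneous_def y_def Q_def lookup_restrict_poly fun_eq_iff split: if_splits)
  moreover have "z b \<sigma> = res_diff p y b \<sigma>" for b \<sigma>
  proof (cases "b < length (s p) \<and> card \<sigma> = q")
    case True
    have "res_diff p y b \<sigma> = (\<Sum>c<length (s (Suc p)). A p $$ (b, c) * restrict_poly (Q (s (Suc p) ! c)) (w \<sigma> c))"
      using True by (simp add: res_diff_def y_def)
    also have "\<dots> = (\<Sum>c<length (s (Suc p)). restrict_poly (Q (s p ! b)) (A p $$ (b, c) * w \<sigma> c))"
    proof (intro sum.cong refl restrict_poly_mult[symmetric])
      fix c m1 m2 assume "c \<in> {..<length (s (Suc p))}" "m1 \<in> Poly_Mapping.keys (A p $$ (b, c))"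
      then have "monom_deg m1 + s p ! b = s (Suc p) ! c"
        using A_degree True by simp
      then show "Q (s p ! b) (m1 + m2) \<longleftrightarrow> Q (s (Suc p) ! c) m2"
        by (auto simp: Q_def monom_deg_add)
    qed
    also have "\<dots> = restrict_poly (Q (s p ! b)) (z b \<sigma>)"
      using True w by (simp add: restrict_poly_sum)
    also have "\<dots> = z b \<sigma>"
    proof (rule poly_mapping_eqI)
      have "homogeneous q (s p ! b) j (z b)"
        using z True by (auto simp: cell_def)
      then show "Poly_Mapping.lookup (restrict_poly (Q (s p ! b)) (z b \<sigma>)) m = Poly_Mapping.lookup (z b \<sigma>) m" for m
        by (auto simp: lookup_restrict_poly homogeneous_def Q_def)
    qed
    finally show ?thesis ..
  next
    case False
    then have "z b \<sigma> = 0"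
      using z cell_outside cell_wrong_card by blast
    moreover have "res_diff p y b \<sigma> = 0"
      using False by (auto simp: res_diff_def y_def)
    ultimately show ?thesis
      by simp
  qed
  ultimately show thesis
    using that[of y] by (simp add: fun_eq_iff)
qed

lemma res_diff_exact:
  assumes z: "cell (Suc p) q z" and cyc: "res_diff p z = (\<lambda>b \<sigma>. 0)"
  obtains y where "cell (Suc (Suc p)) q y" "z = res_diff (Suc p) y"
proof -
  have "in_image (Suc p) (\<lambda>b. z b \<sigma>)" for \<sigma>
    unfolding in_image_Suc_iff
  proof (intro allI impI)
    fix b assume "b < length (s p)"
    then show "(\<Sum>c<length (s (Suc p)). A p $$ (b, c) * z c \<sigma>) = 0"
      using fun_cong[OF fun_cong[OF cyc, of b], of \<sigma>] by (simp add: res_diff_def)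
  qed
  then show thesis
    using lift_res_diff[OF z] that by blast
qed

text \<open>Exactness at \<open>F 0\<close>: in column zero, working modulo the image of the
  resolution is working modulo the ideal. This ties the double complex to the Koszul complex of
  \<open>R / I\<close>.\<close>

lemma res_diff_0_iff:
  assumes z: "cell 0 q z"
  shows "(\<exists>y. cell (Suc 0) q y \<and> z = res_diff 0 y) \<longleftrightarrow> (\<forall>\<sigma>. z 0 \<sigma> \<in> edge_ideal E)"
proof
  assume "\<exists>y. cell (Suc 0) q y \<and> z = res_diff 0 y"
  then obtain y where y: "z = res_diff 0 y"
    by blast
  have "in_image 0 (\<lambda>b. z b \<sigma>)" for \<sigma>
    by (auto simp: in_image_def y res_diff_def intro!: exI[of _ "\<lambda>c. y c \<sigma>"])
  then show "\<forall>\<sigma>. z 0 \<sigma> \<in> edge_ideal E"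
    by (simp add: in_image_0_iff)
next
  assume "\<forall>\<sigma>. z 0 \<sigma> \<in> edge_ideal E"
  then show "\<exists>y. cell (Suc 0) q y \<and> z = res_diff 0 y"
    using lift_res_diff[OF z] in_image_0_iff by metis
qed

lemma kos_diff_exact:
  assumes z: "cell p q z" and cyc: "kos_diff z = (\<lambda>b \<sigma>. 0)" and const: "\<And>b. Poly_Mapping.lookup (z b {}) 0 = 0"
  obtains y where "cell p (Suc q) y" "z = kos_diff y"
proof -
  have "\<exists>y. homogeneous (Suc q) (s p ! b) j y \<and> (\<forall>\<sigma>. z b \<sigma> = koszul y \<sigma>)" if "b < length (s p)" for b
  proof (rule koszul_exact[of q "s p ! b" j "z b"])
    show "homogeneous q (s p ! b) j (z b)"
      using z that by (auto simp: cell_def)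
    show "koszul (z b) \<sigma> = 0" for \<sigma>
      using fun_cong[OF fun_cong[OF cyc, of b], of \<sigma>] by (simp add: kos_diff_def)
  qed (use const in auto)
  then obtain Y where Y: "\<And>b. b < length (s p) \<Longrightarrow> homogeneous (Suc q) (s p ! b) j (Y b)"
    "\<And>b \<sigma>. b < length (s p) \<Longrightarrow> z b \<sigma> = koszul (Y b) \<sigma>"
    by metis
  define y where "y b = (if b < length (s p) then Y b else (\<lambda>\<sigma>. 0))" for b
  have "cell p (Suc q) y"
    using Y by (auto simp: cell_def y_def)
  moreover have "z b \<sigma> = kos_diff y b \<sigma>" for b \<sigma>
    using Y(2)[of b \<sigma>] cell_outside[OF z, of b \<sigma>] by (auto simp: kos_diff_def y_def koszul_def)
  ultimately show thesis
    using that[of y] by (simp add: fun_eq_iff)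
qed

section \<open>Walks along antidiagonals of the double complex\<close>

lemma kos_diff_row_0:
  assumes z: "cell p 0 z"
  shows "kos_diff z = (\<lambda>b \<sigma>. 0)"
proof (intro ext)
  fix b \<sigma>
  show "kos_diff z b \<sigma> = 0"
  proof (cases "b < length (s p)")
    case True
    then have "homogeneous 0 (s p ! b) j (z b)"
      using z by (auto simp: cell_def)
    then show ?thesis
      unfolding kos_diff_def by (rule koszul_exterior_degree_0)
  next
    case False
    then show ?thesis
      using cell_outside[OF z False] by (simp add: kos_diff_def koszul_def)
  qed
qed

text \<open>This is where minimality enters: no matrix entry has a constant term.\<close>

lemma lookup_hd_const: "Poly_Mapping.lookup (res_diff p z b \<sigma>) 0 = 0"
  using A_minimal[of b p] by (auto simp: res_diff_def lookup_sum lookup_mult_const_0 intro!: sum.neutral)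

text \<open>The correction \<open>w\<close> satisfies the same kind of hypothesis one column further
  and one row lower, and splitting it makes \<open>z\<close> a Koszul cycle up to an image of
  \<open>res_diff\<close>. In row zero the only obstruction is a constant at a generator of degree
  \<open>j\<close>, which the first assumption excludes.\<close>

lemma staircase_vanish:
  assumes "j \<notin> set (s (p + q))" and "cell p q z" and "cell (Suc p) (q - 1) w" and "kos_diff z = res_diff p w"
  shows "\<exists>x y. cell p (Suc q) x \<and> cell (Suc p) q y \<and> z = (\<lambda>b \<sigma>. kos_diff x b \<sigma> + res_diff p y b \<sigma>)"
  using assms
proof (induction q arbitrary: p z w)
  case 0
  have "Poly_Mapping.lookup (z b {}) 0 = 0" for b
  proof (cases "b < length (s p)")
    case True
    then have "homogeneous 0 (s p ! b) j (z b)" "s p ! b \<noteq> j"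
      using 0 nth_mem[of b "s p"] by (auto simp: cell_def)
    moreover have "monom_deg (0 :: 'v \<Rightarrow>\<^sub>0 nat) = 0"
      by (simp add: monom_deg_def)
    ultimately show ?thesis
      unfolding homogeneous_def by (metis add_0)
  qed (use 0 in \<open>simp add: cell_def\<close>)
  then obtain x where x: "cell p (Suc 0) x" "z = kos_diff x"
    using kos_diff_exact[OF 0(2) kos_diff_row_0[OF 0(2)]] by blast
  then show ?case
    by (intro exI[of _ x] exI[of _ "\<lambda>b \<sigma>. 0"]) simp
next
  case (Suc q)
  have w: "cell (Suc p) q w"
    using Suc.prems(3) by simp
  have "res_diff p (kos_diff w) = (\<lambda>b \<sigma>. 0)"
    using Suc.prems(4) kos_diff_res_diff[of p w] by (metis kos_diff_kos_diff)
  then obtain w' where w': "cell (Suc (Suc p)) (q - 1) w'" "kos_diff w = res_diff (Suc p) w'"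
    using res_diff_exact[OF cell_kos_diff[OF w]] by blast
  then obtain x y where xy: "cell (Suc p) (Suc q) x" "w = (\<lambda>b \<sigma>. kos_diff x b \<sigma> + res_diff (Suc p) y b \<sigma>)"
    using Suc.IH[of "Suc p" w w'] Suc.prems(1) w by auto
  define u where "u = (\<lambda>b \<sigma>. z b \<sigma> - res_diff p x b \<sigma>)"
  have "res_diff p w = res_diff p (kos_diff x)"
    by (simp add: xy(2) res_diff_add)
  then have "kos_diff u = (\<lambda>b \<sigma>. 0)"
    by (simp add: u_def kos_diff_diff Suc.prems(4) kos_diff_res_diff)
  moreover have u: "cell p (Suc q) u"
    unfolding u_def using Suc.prems(2) cell_res_diff[OF xy(1)] by (rule cell_diff)
  moreover have "Poly_Mapping.lookup (u b {}) 0 = 0" for b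
    using cell_wrong_card[OF u, of "{}" b] by simp
  ultimately obtain v where "cell p (Suc (Suc q)) v" "u = kos_diff v"
    using kos_diff_exact by metis
  moreover from this have "z = (\<lambda>b \<sigma>. kos_diff v b \<sigma> + res_diff p x b \<sigma>)"
    by (auto simp: u_def fun_eq_iff diff_eq_eq)
  ultimately show ?case
    using xy(1) by blast
qed

text \<open>The reverse walk, from a generator in row zero. There its constant term survives, since
  neither differential produces constants; each step lifts through Koszul exactness, and exactness
  of the resolution carries triviality back.\<close>

lemma staircase_nontrivial:
  assumes "cell (p + q) 0 e" and "Poly_Mapping.lookup (e b {}) 0 \<noteq> 0"
  shows "\<exists>z w. cell p q z \<and> cell (Suc p) (q - 1) w \<and> kos_diff z = res_diff p w \<and>
    \<not> (\<exists>x y. cell p (Suc q) x \<and> cell (Suc p) q y \<and> z = (\<lambda>b \<sigma>. kos_diff x b \<sigma> + res_diff p y b \<sigma>))"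
  using assms(1)
proof (induction q arbitrary: p)
  case 0
  have "e \<noteq> (\<lambda>b \<sigma>. kos_diff x b \<sigma> + res_diff p y b \<sigma>)" for x y
    using assms(2) by (auto simp: lookup_add lookup_hd_const kos_diff_def lookup_koszul_const)
  moreover have "kos_diff e = (\<lambda>b \<sigma>. 0)"
    using 0 by (intro kos_diff_row_0) simp
  ultimately show ?case
    using 0 by (intro exI[of _ e] exI[of _ "\<lambda>b \<sigma>. 0"]) auto
next
  case (Suc q)
  then have "cell (Suc p + q) 0 e"
    by simp
  from Suc.IH[OF this] obtain z w where z: "cell (Suc p) q z" and w: "kos_diff z = res_diff (Suc p) w"
    and nt: "\<And>x y. cell (Suc p) (Suc q) x \<Longrightarrow> cell (Suc (Suc p)) q y \<Longrightarrow> z \<noteq> (\<lambda>b \<sigma>. kos_diff x b \<sigma> + res_diff (Suc p) y b \<sigma>)"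
    by blast
  have "kos_diff (res_diff p z) = (\<lambda>b \<sigma>. 0)"
    by (simp add: kos_diff_res_diff w)
  then obtain z' where z': "cell p (Suc q) z'" "res_diff p z = kos_diff z'"
    using kos_diff_exact[OF cell_res_diff[OF z]] lookup_hd_const by metis
  have "z' \<noteq> (\<lambda>b \<sigma>. kos_diff x b \<sigma> + res_diff p y b \<sigma>)" if y: "cell (Suc p) (Suc q) y" for x y
  proof
    assume eq: "z' = (\<lambda>b \<sigma>. kos_diff x b \<sigma> + res_diff p y b \<sigma>)"
    \<comment> \<open>If \<open>z'\<close> were trivial, \<open>u\<close> would be a cycle of the
      resolution, hence an image, making \<open>z\<close> trivial in the previous column.\<close>
    define u where "u = (\<lambda>b \<sigma>. z b \<sigma> - kos_diff y b \<sigma>)"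
    have "res_diff p u = (\<lambda>b \<sigma>. 0)"
      by (simp add: u_def res_diff_diff z'(2) eq kos_diff_add kos_diff_res_diff)
    moreover have "cell (Suc p) q u"
      unfolding u_def using z cell_kos_diff[OF y] by (intro cell_diff) auto
    ultimately obtain x' where "cell (Suc (Suc p)) q x'" "u = res_diff (Suc p) x'"
      using res_diff_exact by metis
    moreover from this have "z = (\<lambda>b \<sigma>. kos_diff y b \<sigma> + res_diff (Suc p) x' b \<sigma>)"
      by (auto simp: u_def fun_eq_iff diff_eq_eq algebra_simps)
    ultimately show False
      using nt y by blast
  qed
  then show ?case
    using z' z by (intro exI[of _ z'] exI[of _ z]) auto
qed

lemma cell_0_iff: "cell 0 q z \<longleftrightarrow> homogeneous q 0 j (z 0) \<and> (\<forall>b>0. z b = (\<lambda>\<sigma>. 0))"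
  by (auto simp: cell_def s_0)

text \<open>The cycle is placed in column zero, and \<open>staircase_vanish\<close> runs down to the
  generators of \<open>F\<^sub>i\<close>.\<close>

lemma koszul_boundary_if_no_generator:
  assumes "j \<notin> set (s i)" and z: "koszul_cycle E i j (z :: 'v set \<Rightarrow> ('v, 'k) mpoly)"
  shows "koszul_boundary E i j z"
proof -
  define Z where "Z b = (if b = 0 then z else (\<lambda>\<sigma>. 0))" for b :: nat
  have Z: "cell 0 i Z"
    using z by (simp add: cell_0_iff Z_def koszul_cycle_def)
  have "\<forall>\<sigma>. kos_diff Z 0 \<sigma> \<in> edge_ideal E"
    using z by (simp add: kos_diff_def Z_def koszul_cycle_def)
  then obtain w where "cell (Suc 0) (i - 1) w" "kos_diff Z = res_diff 0 w"
    using res_diff_0_iff[OF cell_kos_diff[OF Z]] by blast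
  then obtain x y where xy: "cell 0 (Suc i) x" "cell (Suc 0) i y" "Z = (\<lambda>b \<sigma>. kos_diff x b \<sigma> + res_diff 0 y b \<sigma>)"
    using staircase_vanish[of 0 i Z w] Z assms(1) by auto
  have "res_diff 0 y 0 \<sigma> \<in> edge_ideal E" for \<sigma>
    using res_diff_0_iff[OF cell_res_diff[OF xy(2)]] xy(2) by blast
  moreover have "z \<sigma> - koszul (x 0) \<sigma> = res_diff 0 y 0 \<sigma>" for \<sigma>
    using fun_cong[OF fun_cong[OF xy(3), of 0], of \<sigma>] by (simp add: Z_def kos_diff_def)
  ultimately show ?thesis
    using xy(1) unfolding koszul_boundary_def cell_0_iff by metis
qed

lemma generator_koszul_cycle:
  assumes "j \<in> set (s i)"
  obtains z :: "'v set \<Rightarrow> ('v, 'k) mpoly" where "koszul_cycle E i j z" "\<not> koszul_boundary E i j z"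
proof -
  obtain b where b: "b < length (s i)" "s i ! b = j"
    using assms by (metis in_set_conv_nth)
  \<comment> \<open>The chosen basis element of \<open>F\<^sub>i\<close> itself, with exterior part
    1; its degree \<open>j\<close> puts it in row zero of column \<open>i\<close>.\<close>
  define e :: "nat \<Rightarrow> 'v set \<Rightarrow> ('v, 'k) mpoly" where "e c \<sigma> = (if c = b \<and> \<sigma> = {} then 1 else 0)" for c \<sigma>
  have "cell i 0 e"
    using b by (auto simp: cell_def homogeneous_def e_def lookup_one when_def monom_deg_def fun_eq_iff split: if_splits)
  moreover have "Poly_Mapping.lookup (e b {}) 0 \<noteq> 0"
    by (simp add: e_def)
  ultimately obtain z w where z: "cell 0 i z" and w: "cell (Suc 0) (i - 1) w" "kos_diff z = res_diff 0 w"
    and nt: "\<And>x y. cell 0 (Suc i) x \<Longrightarrow> cell (Suc 0) i y \<Longrightarrow> z \<noteq> (\<lambda>b \<sigma>. kos_diff x b \<sigma> + res_diff 0 y b \<sigma>)"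
    using staircase_nontrivial[of 0 i e b] by auto
  have "kos_diff z 0 \<sigma> \<in> edge_ideal E" for \<sigma>
    using res_diff_0_iff[OF cell_kos_diff[OF z]] w by blast
  then have "koszul_cycle E i j (z 0)"
    using z by (simp add: koszul_cycle_def cell_0_iff kos_diff_def)
  moreover have "\<not> koszul_boundary E i j (z 0)"
  proof
    assume "koszul_boundary E i j (z 0)"
    then obtain y where y: "homogeneous (Suc i) 0 j y" "\<And>\<sigma>. z 0 \<sigma> - koszul y \<sigma> \<in> edge_ideal E"
      by (auto simp: koszul_boundary_def)
    define x where "x b = (if b = 0 then y else (\<lambda>\<sigma>. 0))" for b :: nat
    have x: "cell 0 (Suc i) x"
      using y by (simp add: cell_0_iff x_def)
    define u where "u = (\<lambda>b \<sigma>. z b \<sigma> - kos_diff x b \<sigma>)"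
    have "cell 0 i u"
      unfolding u_def using z cell_kos_diff[OF x] by (intro cell_diff) auto
    moreover have "\<forall>\<sigma>. u 0 \<sigma> \<in> edge_ideal E"
      using y(2) by (simp add: u_def kos_diff_def x_def)
    ultimately obtain y' where "cell (Suc 0) i y'" "u = res_diff 0 y'"
      using res_diff_0_iff by blast
    moreover from this have "z = (\<lambda>b \<sigma>. kos_diff x b \<sigma> + res_diff 0 y' b \<sigma>)"
      by (auto simp: u_def fun_eq_iff diff_eq_eq algebra_simps)
    ultimately show False
      using nt x by blast
  qed
  ultimately show thesis
    by (rule that)
qed

end

theorem theorem1p8:
  fixes E :: "'v::finite set set" and k :: nat and a :: "nat \<Rightarrow> nat"
  assumes "simple_graph E" and "E \<noteq> {}"
    and "has_jump_sequence (edge_ideal E :: ('v, 'k::field_char_0) mpoly set) k a"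
    and "k \<ge> 3"
  shows "2 * a 1 \<le> a 2"
proof -
  obtain \<beta> where \<beta>: "has_graded_betti_numbers (edge_ideal E :: ('v, 'k) mpoly set) \<beta>"
    and jump: "\<And>r. 1 \<le> r \<Longrightarrow> r \<le> k - 1 \<Longrightarrow> \<beta> (a r + 1) ((a r + 1) + r + 1) \<noteq> 0 \<and>
           (\<forall>i. \<beta> i (i + r + 1) \<noteq> 0 \<longrightarrow> a r + 1 \<le> i)"
    using assms(3) by (auto simp: has_jump_sequence_def)
  obtain s and A :: "nat \<Rightarrow> ('v, 'k) mpoly mat" where
    res: "minimal_graded_free_resolution (edge_ideal E) s A" and count: "\<And>i j. \<beta> i j = count_list (s i) j"
    using \<beta> by (auto simp: has_graded_betti_numbers_def)
  interpret graded_resolution E s A j for j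
    using assms(1) res by unfold_locales
  \<comment> \<open>A class on edges supported on \<open>i + 2\<close> vertices forces a Betti
    number with \<open>r = 1\<close> in homological degree \<open>i\<close>, so
    \<open>a 1 + 1\<close> bounds \<open>i\<close>.\<close>
  have bound: "a 1 + 3 \<le> card S" if \<phi>: "nontrivial E 2 S (\<phi> :: 'v set \<Rightarrow> 'k)" for S \<phi>
  proof -
    have "2 \<le> card S"
    proof (rule ccontr)
      assume "\<not> 2 \<le> card S"
      then have "card \<tau> \<noteq> 2" if "\<tau> \<subseteq> S" for \<tau>
        using card_mono[of S \<tau>] that by auto
      then show False
        using \<phi> by (auto simp: nontrivial_def coboundary_def)
    qed
    then obtain i where i: "card S = i + 2"
      by (metis add.commute le_Suc_ex)
    obtain z :: "'v set \<Rightarrow> ('v, 'k) mpoly" where "koszul_cycle E i (i + 2) z" "\<not> koszul_boundary E i (i + 2) z"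
      using nontrivial_koszul_cycle[OF assms(1) \<phi> i] by blast
    then have "\<beta> i (i + 1 + 1) \<noteq> 0"
      using koszul_boundary_if_no_generator[of "i + 2" i z] by (auto simp: count count_list_0_iff)
    then have "a 1 + 1 \<le> i"
      using jump[of 1] assms(4) by simp
    then show ?thesis
      using i by simp
  qed
  \<comment> \<open>At \<open>r = 2\<close> the internal degree is \<open>a 2 + 4\<close>; it
    becomes the size of a vertex set carrying a class on triangles, and comparing it with
    \<open>2 * a 1 + 4\<close> gives the claim.\<close>
  have "\<beta> (a 2 + 1) (a 2 + 1 + 2 + 1) \<noteq> 0"
    using jump[of 2] assms(4) by linarith
  moreover have "a 2 + 1 + 2 + 1 = a 2 + 1 + Suc 2"
    by simp
  ultimately have "a 2 + 1 + Suc 2 \<in> set (s (a 2 + 1))"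
    by (metis count count_list_0_iff)
  then obtain z :: "'v set \<Rightarrow> ('v, 'k) mpoly" where
    "koszul_cycle E (a 2 + 1) (a 2 + 1 + Suc 2) z" "\<not> koszul_boundary E (a 2 + 1) (a 2 + 1 + Suc 2) z"
    by (rule generator_koszul_cycle)
  then obtain W and \<phi> :: "'v set \<Rightarrow> 'k" where "card W = a 2 + 1 + Suc 2" "nontrivial E (Suc 2) W \<phi>"
    using koszul_cycle_nontrivial[OF assms(1)] by blast
  then show ?thesis
    using nontrivial_size_bound[OF assms(1), of W \<phi> "a 1"] bound by simp
qed

end
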